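(* Let $A$ be a finite dimensional algebra over a field $k$. The following are equivalent: (1) $A$ is brick-directed; (2) there exists a maximal chain $\{\mathcal{T}_i\}_{i\in I}$ in $\operatorname{tors} A$ such that every $\mathcal{T}_i$ is a brick-splitting torsion class.
   Context: $\operatorname{mod} A$ is the category of finitely generated left $A$-modules. A brick is a module $X\in\operatorname{mod} A$ such that $\operatorname{End}_A(X)$ is a division algebra. A brick-cycle in $\operatorname{mod} A$ is a sequence $X_0\xrightarrow{f_1}X_1\xrightarrow{f_2}\cdots\xrightarrow{f_m}X_m$ with $m\ge 1$, all $X_i$ bricks, $X_0\simeq X_m$, and each $f_j$ non-zero and non-invertible. $A$ is brick-directed if $\operatorname{mod} A$ contains no brick-cycle. $\operatorname{tors} A$ is the poset (a complete lattice) of torsion classes in $\operatorname{mod} A$ ordered by inclusion. A torsion class $\mathcal{T}$ is brick-splitting if every brick belongs to $\mathcal{T}$ or to $\mathcal{T}^{\perp}=\{X\in\operatorname{mod} A\mid\operatorname{Hom}_A(T,X)=0\ \forall T\in\mathcal{T}\}$. A chain in a poset is a totally ordered subset (possibly infinite); it is maximal if it is not properly contained in another chain. *)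

theory Defs
  imports "HOL-Algebra.Module" "HOL-Algebra.AbelCoset"
begin

section \<open>Finite-dimensional algebras and their modules\<close>

definition finitely_generated ::
    "('a, 'r) ring_scheme \<Rightarrow> ('a, 'b, 'm) module_scheme \<Rightarrow> bool" where
  "finitely_generated R M \<longleftrightarrow>
     (\<exists>S. finite S \<and> S \<subseteq> carrier M \<and>
        (\<forall>x \<in> carrier M. \<exists>c \<in> S \<rightarrow> carrier R. x = (\<Oplus>\<^bsub>M\<^esub>s\<in>S. c s \<odot>\<^bsub>M\<^esub> s)))"

text \<open>The library locale \<^locale>\<open>algebra\<close> only covers commutative algebras, and
  \<^locale>\<open>module\<close> only modules over commutative rings.\<close>

locale fin_dim_algebra = module K A + K?: field K + A?: ring A
    for K :: "('k, 'r) ring_scheme" (structure)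
      and A :: "('k, 'a, 's) module_scheme" (structure) +
  assumes smult_mult_left:
      "\<lbrakk>c \<in> carrier K; x \<in> carrier A; y \<in> carrier A\<rbrakk> \<Longrightarrow>
        (c \<odot>\<^bsub>A\<^esub> x) \<otimes>\<^bsub>A\<^esub> y = c \<odot>\<^bsub>A\<^esub> (x \<otimes>\<^bsub>A\<^esub> y)"
    and smult_mult_right:
      "\<lbrakk>c \<in> carrier K; x \<in> carrier A; y \<in> carrier A\<rbrakk> \<Longrightarrow>
        x \<otimes>\<^bsub>A\<^esub> (c \<odot>\<^bsub>A\<^esub> y) = c \<odot>\<^bsub>A\<^esub> (x \<otimes>\<^bsub>A\<^esub> y)"
    and finite_dim: "finitely_generated K A"

locale left_module = R?: ring R + M?: abelian_group M
    for R :: "('a, 'r) ring_scheme" (structure)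
      and M :: "('a, 'b, 'm) module_scheme" (structure) +
  assumes smult_closed [simp, intro]:
      "\<lbrakk>a \<in> carrier R; x \<in> carrier M\<rbrakk> \<Longrightarrow> a \<odot>\<^bsub>M\<^esub> x \<in> carrier M"
    and smult_l_distr:
      "\<lbrakk>a \<in> carrier R; b \<in> carrier R; x \<in> carrier M\<rbrakk> \<Longrightarrow>
        (a \<oplus> b) \<odot>\<^bsub>M\<^esub> x = a \<odot>\<^bsub>M\<^esub> x \<oplus>\<^bsub>M\<^esub> b \<odot>\<^bsub>M\<^esub> x"
    and smult_r_distr:
      "\<lbrakk>a \<in> carrier R; x \<in> carrier M; y \<in> carrier M\<rbrakk> \<Longrightarrow>
        a \<odot>\<^bsub>M\<^esub> (x \<oplus>\<^bsub>M\<^esub> y) = a \<odot>\<^bsub>M\<^esub> x \<oplus>\<^bsub>M\<^esub> a \<odot>\<^bsub>M\<^esub> y"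
    and smult_assoc:
      "\<lbrakk>a \<in> carrier R; b \<in> carrier R; x \<in> carrier M\<rbrakk> \<Longrightarrow>
        (a \<otimes> b) \<odot>\<^bsub>M\<^esub> x = a \<odot>\<^bsub>M\<^esub> (b \<odot>\<^bsub>M\<^esub> x)"
    and smult_one [simp]:
      "x \<in> carrier M \<Longrightarrow> \<one> \<odot>\<^bsub>M\<^esub> x = x"

text \<open>Morphisms are extensional functions, so that equality of morphisms is equality
  of functions.\<close>

definition Hom ::
    "('a, 'r) ring_scheme \<Rightarrow> ('a, 'b, 'm) module_scheme \<Rightarrow> ('a, 'c, 'n) module_scheme
      \<Rightarrow> ('b \<Rightarrow> 'c) set" where
  "Hom R M N =
     {f \<in> carrier M \<rightarrow>\<^sub>E carrier N.
        (\<forall>x \<in> carrier M. \<forall>y \<in> carrier M. f (x \<oplus>\<^bsub>M\<^esub> y) = f x \<oplus>\<^bsub>N\<^esub> f y) \<and>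
        (\<forall>a \<in> carrier R. \<forall>x \<in> carrier M. f (a \<odot>\<^bsub>M\<^esub> x) = a \<odot>\<^bsub>N\<^esub> f x)}"

definition zero_hom ::
    "('a, 'b, 'm) module_scheme \<Rightarrow> ('a, 'c, 'n) module_scheme \<Rightarrow> 'b \<Rightarrow> 'c" where
  "zero_hom M N = (\<lambda>x \<in> carrier M. \<zero>\<^bsub>N\<^esub>)"

definition module_iso ::
    "('a, 'r) ring_scheme \<Rightarrow> ('a, 'b, 'm) module_scheme \<Rightarrow> ('a, 'c, 'n) module_scheme
      \<Rightarrow> ('b \<Rightarrow> 'c) set" where
  "module_iso R M N = {f \<in> Hom R M N. bij_betw f (carrier M) (carrier N)}"

definition isomorphic ::
    "('a, 'r) ring_scheme \<Rightarrow> ('a, 'b, 'm) module_scheme \<Rightarrow> ('a, 'c, 'n) module_scheme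
      \<Rightarrow> bool" where
  "isomorphic R M N \<longleftrightarrow> module_iso R M N \<noteq> {}"

text \<open>Objects of the category of finitely generated left modules are taken with carrier
  inside the fixed type \<^typ>\<open>nat \<Rightarrow> 'a\<close>. This type is large enough: every finitely
  generated left module over \<open>R\<close>, with carrier in any type, is isomorphic to one of these
  (lemma \<open>fg_mod_universal\<close> below). The fields for multiplication and unit that
  \<^typ>\<open>('a, 'b) module\<close> inherits from rings are ignored, as everywhere in the library.\<close>

definition fg_mod :: "('a, 'r) ring_scheme \<Rightarrow> ('a, nat \<Rightarrow> 'a) module set" where
  "fg_mod R = {M. left_module R M \<and> finitely_generated R M}"

section \<open>Bricks\<close>

definition End_ring ::
    "('a, 'r) ring_scheme \<Rightarrow> ('a, 'b, 'm) module_scheme \<Rightarrow> ('b \<Rightarrow> 'b) ring" where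
  "End_ring R M =
     \<lparr>carrier = Hom R M M,
      monoid.mult = (\<lambda>f g. compose (carrier M) f g),
      monoid.one = (\<lambda>x \<in> carrier M. x),
      ring.zero = zero_hom M M,
      ring.add = (\<lambda>f g. \<lambda>x \<in> carrier M. f x \<oplus>\<^bsub>M\<^esub> g x)\<rparr>"

text \<open>Not necessarily commutative. For a module over an algebra over a field, the
  endomorphism ring is automatically an algebra over that field, so it is a division
  algebra exactly when its underlying ring satisfies the following.\<close>

locale skew_field = ring +
  assumes one_not_zero: "\<one> \<noteq> \<zero>"
    and Units_eq: "Units R = carrier R - {\<zero>}"

definition brick :: "('a, 'r) ring_scheme \<Rightarrow> ('a, nat \<Rightarrow> 'a) module \<Rightarrow> bool" where
  "brick R X \<longleftrightarrow> X \<in> fg_mod R \<and> skew_field (End_ring R X)"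

definition brick_cycle ::
    "('a, 'r) ring_scheme \<Rightarrow> nat \<Rightarrow> (nat \<Rightarrow> ('a, nat \<Rightarrow> 'a) module)
      \<Rightarrow> (nat \<Rightarrow> (nat \<Rightarrow> 'a) \<Rightarrow> (nat \<Rightarrow> 'a)) \<Rightarrow> bool" where
  "brick_cycle R m X f \<longleftrightarrow>
     1 \<le> m \<and> (\<forall>i \<le> m. brick R (X i)) \<and> isomorphic R (X 0) (X m) \<and>
     (\<forall>j \<in> {1..m}. f j \<in> Hom R (X (j - 1)) (X j) \<and>
        f j \<noteq> zero_hom (X (j - 1)) (X j) \<and>
        f j \<notin> module_iso R (X (j - 1)) (X j))"

definition brick_directed :: "('a, 'r) ring_scheme \<Rightarrow> bool" where
  "brick_directed R \<longleftrightarrow> (\<nexists>m X f. brick_cycle R m X f)"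

section \<open>Torsion classes\<close>

text \<open>Closure under isomorphism is a special case of closure under quotients.\<close>

definition torsion_class ::
    "('a, 'r) ring_scheme \<Rightarrow> ('a, nat \<Rightarrow> 'a) module set \<Rightarrow> bool" where
  "torsion_class R \<T> \<longleftrightarrow>
     \<T> \<subseteq> fg_mod R \<and> \<T> \<noteq> {} \<and>
     (\<forall>X \<in> \<T>. \<forall>Y \<in> fg_mod R. \<forall>g \<in> Hom R X Y.
        g ` carrier X = carrier Y \<longrightarrow> Y \<in> \<T>) \<and>
     (\<forall>X \<in> \<T>. \<forall>Z \<in> \<T>. \<forall>Y \<in> fg_mod R. \<forall>f \<in> Hom R X Y. \<forall>g \<in> Hom R Y Z.
        inj_on f (carrier X) \<and> f ` carrier X = a_kernel Y Z g \<and>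
        g ` carrier Y = carrier Z \<longrightarrow> Y \<in> \<T>)"

definition tors :: "('a, 'r) ring_scheme \<Rightarrow> ('a, nat \<Rightarrow> 'a) module set set" where
  "tors R = {\<T>. torsion_class R \<T>}"

definition hom_orthogonal ::
    "('a, 'r) ring_scheme \<Rightarrow> ('a, nat \<Rightarrow> 'a) module set
      \<Rightarrow> ('a, nat \<Rightarrow> 'a) module set" where
  "hom_orthogonal R \<T> = {X \<in> fg_mod R. \<forall>T \<in> \<T>. Hom R T X = {zero_hom T X}}"

definition brick_splitting ::
    "('a, 'r) ring_scheme \<Rightarrow> ('a, nat \<Rightarrow> 'a) module set \<Rightarrow> bool" where
  "brick_splitting R \<T> \<longleftrightarrow>
     torsion_class R \<T> \<and> (\<forall>X. brick R X \<longrightarrow> X \<in> \<T> \<or> X \<in> hom_orthogonal R \<T>)"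

section \<open>Adequacy of the definitions\<close>

context left_module
begin

lemma add_in:
  assumes "f \<in> Hom R M M" "g \<in> Hom R M M"
  shows "(\<lambda>x \<in> carrier M. f x \<oplus>\<^bsub>M\<^esub> g x) \<in> Hom R M M"
  using assms by (auto simp: Hom_def PiE_iff M.a_ac smult_r_distr)

lemma smult_zero_right: "a \<in> carrier R \<Longrightarrow> a \<odot>\<^bsub>M\<^esub> \<zero>\<^bsub>M\<^esub> = \<zero>\<^bsub>M\<^esub>"
  by (metis M.add.l_cancel_one M.zero_closed M.l_zero smult_closed smult_r_distr)

lemma smult_minus:
  assumes "a \<in> carrier R" "x \<in> carrier M"
  shows "a \<odot>\<^bsub>M\<^esub> (\<ominus>\<^bsub>M\<^esub> x) = \<ominus>\<^bsub>M\<^esub> (a \<odot>\<^bsub>M\<^esub> x)"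
proof -
  have "a \<odot>\<^bsub>M\<^esub> (\<ominus>\<^bsub>M\<^esub> x) \<oplus>\<^bsub>M\<^esub> a \<odot>\<^bsub>M\<^esub> x = \<zero>\<^bsub>M\<^esub>"
    using assms smult_r_distr[of a "\<ominus>\<^bsub>M\<^esub> x" x] by (simp add: M.l_neg smult_zero_right)
  then show ?thesis
    using assms by (simp add: M.minus_equality)
qed

lemma zero_hom_in: "zero_hom M M \<in> Hom R M M"
  by (auto simp: Hom_def zero_hom_def smult_zero_right)

lemma id_in: "(\<lambda>x \<in> carrier M. x) \<in> Hom R M M"
  by (auto simp: Hom_def)

lemma compose_in:
  "f \<in> Hom R M M \<Longrightarrow> g \<in> Hom R M M \<Longrightarrow> compose (carrier M) f g \<in> Hom R M M"
  by (auto simp: Hom_def PiE_iff compose_def)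

lemma HomD:
  assumes "f \<in> Hom R M M"
  shows "x \<in> carrier M \<Longrightarrow> f x \<in> carrier M"
    "x \<in> carrier M \<Longrightarrow> y \<in> carrier M \<Longrightarrow> f (x \<oplus>\<^bsub>M\<^esub> y) = f x \<oplus>\<^bsub>M\<^esub> f y"
    "f \<in> extensional (carrier M)"
  using assms by (auto simp: Hom_def PiE_iff)

lemma ext_Hom:
  assumes "f \<in> extensional (carrier M)" "g \<in> extensional (carrier M)"
    "\<And>x. x \<in> carrier M \<Longrightarrow> f x = g x"
  shows "f = g"
  using assms by (rule extensionalityI)

lemma ring_End_ring: "ring (End_ring R M)"
proof (rule ringI)
  show "abelian_group (End_ring R M)"
  proof (rule abelian_groupI)
    fix f assume "f \<in> carrier (End_ring R M)"
    then have f: "f \<in> Hom R M M" by (simp add: End_ring_def)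
    let ?g = "\<lambda>x \<in> carrier M. \<ominus>\<^bsub>M\<^esub> (f x)"
    have "?g \<in> Hom R M M"
      using f by (auto simp: Hom_def PiE_iff M.minus_add smult_minus)
    moreover have "(\<lambda>x \<in> carrier M. ?g x \<oplus>\<^bsub>M\<^esub> f x) = zero_hom M M"
      using HomD(1)[OF f] by (auto simp: zero_hom_def restrict_def M.l_neg)
    ultimately show "\<exists>g \<in> carrier (End_ring R M). g \<oplus>\<^bsub>End_ring R M\<^esub> f = \<zero>\<^bsub>End_ring R M\<^esub>"
      by (intro bexI[of _ ?g]) (simp_all add: End_ring_def del: restrict_apply)
  qed (auto simp: End_ring_def add_in zero_hom_in[unfolded zero_hom_def] zero_hom_def HomD M.a_ac
        intro!: ext_Hom)
  show "Group.monoid (End_ring R M)"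
    by (rule monoidI)
      (auto simp: End_ring_def compose_in id_in HomD compose_eq
        intro!: ext_Hom)
qed (auto simp: End_ring_def add_in HomD compose_eq intro!: ext_Hom)

end

lemma fg_mod_universal:
  fixes R :: "('a, 'r) ring_scheme" and M :: "('a, 'b, 'm) module_scheme"
  assumes "left_module R M" "finitely_generated R M"
  shows "\<exists>N \<in> fg_mod R. isomorphic R M N"
proof -
  interpret left_module R M by fact
  obtain S where S: "finite S" "S \<subseteq> carrier M" and
    gen: "\<And>x. x \<in> carrier M \<Longrightarrow> \<exists>c \<in> S \<rightarrow> carrier R. x = (\<Oplus>\<^bsub>M\<^esub>s\<in>S. c s \<odot>\<^bsub>M\<^esub> s)"
    using assms(2) unfolding finitely_generated_def by blast
  obtain c where c: "\<And>x. x \<in> carrier M \<Longrightarrow> c x \<in> S \<rightarrow> carrier R"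
      "\<And>x. x \<in> carrier M \<Longrightarrow> x = (\<Oplus>\<^bsub>M\<^esub>s\<in>S. c x s \<odot>\<^bsub>M\<^esub> s)"
    using gen by metis
  obtain h :: "'b \<Rightarrow> nat" where h: "inj_on h S"
    using finite_imp_inj_to_nat_seg[OF S(1)] by blast
  define p where "p = (\<lambda>x. if x \<in> carrier M then (\<lambda>i. c x (inv_into S h i)) else undefined)"
  have inj: "inj_on p (carrier M)"
  proof (rule inj_onI)
    fix x y assume xy: "x \<in> carrier M" "y \<in> carrier M" "p x = p y"
    have "c x s = c y s" if "s \<in> S" for s
    proof -
      have "p x (h s) = p y (h s)" using xy by simp
      then show ?thesis using xy h that by (simp add: p_def)
    qed
    then have "(\<Oplus>\<^bsub>M\<^esub>s\<in>S. c x s \<odot>\<^bsub>M\<^esub> s) = (\<Oplus>\<^bsub>M\<^esub>s\<in>S. c y s \<odot>\<^bsub>M\<^esub> s)"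
      using S(2) c(1)[OF xy(2)] by (intro M.finsum_cong') auto
    then show "x = y" using c(2)[OF xy(1)] c(2)[OF xy(2)] by simp
  qed
  define q where "q = inv_into (carrier M) p"
  have qp [simp]: "q (p x) = x" if "x \<in> carrier M" for x
    using inj that by (simp add: q_def)
  define N :: "('a, nat \<Rightarrow> 'a) module" where
    "N = \<lparr>carrier = p ` carrier M, monoid.mult = undefined, monoid.one = undefined, ring.zero = p \<zero>\<^bsub>M\<^esub>,
          ring.add = (\<lambda>u v. p (q u \<oplus>\<^bsub>M\<^esub> q v)), smult = (\<lambda>a u. p (a \<odot>\<^bsub>M\<^esub> q u))\<rparr>"
  have N_simps: "carrier N = p ` carrier M" "\<zero>\<^bsub>N\<^esub> = p \<zero>\<^bsub>M\<^esub>"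
     "\<And>u v. u \<oplus>\<^bsub>N\<^esub> v = p (q u \<oplus>\<^bsub>M\<^esub> q v)" "\<And>a u. a \<odot>\<^bsub>N\<^esub> u = p (a \<odot>\<^bsub>M\<^esub> q u)"
    by (simp_all add: N_def)
  have agN: "abelian_group N"
  proof (rule abelian_groupI)
    fix u assume "u \<in> carrier N"
    then obtain x where x: "x \<in> carrier M" "u = p x" by (auto simp: N_simps)
    then show "\<exists>v \<in> carrier N. v \<oplus>\<^bsub>N\<^esub> u = \<zero>\<^bsub>N\<^esub>"
      by (intro bexI[of _ "p (\<ominus>\<^bsub>M\<^esub> x)"]) (auto simp: N_simps M.l_neg)
  qed (auto simp: N_simps M.a_ac)
  interpret N: abelian_group N by fact
  have lmN: "left_module R N"
    by (intro left_module.intro left_module_axioms.intro agN)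
      (use R.ring_axioms in \<open>auto simp: N_simps smult_l_distr smult_r_distr smult_assoc\<close>)
  have p_sum: "p (\<Oplus>\<^bsub>M\<^esub>s\<in>F. f s) = (\<Oplus>\<^bsub>N\<^esub>s\<in>F. p (f s))"
    if "finite F" "f \<in> F \<rightarrow> carrier M" for F :: "'b set" and f
    using that
  proof (induction F)
    case (insert s F)
    have "(\<Oplus>\<^bsub>N\<^esub>t\<in>insert s F. p (f t)) = p (f s) \<oplus>\<^bsub>N\<^esub> (\<Oplus>\<^bsub>N\<^esub>t\<in>F. p (f t))"
      using insert.hyps insert.prems by (intro N.finsum_insert) (auto simp: N_simps(1))
    moreover have "(\<Oplus>\<^bsub>M\<^esub>t\<in>insert s F. f t) = f s \<oplus>\<^bsub>M\<^esub> (\<Oplus>\<^bsub>M\<^esub>t\<in>F. f t)"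
      using insert.hyps insert.prems by (intro M.finsum_insert) auto
    moreover have "(\<Oplus>\<^bsub>M\<^esub>t\<in>F. f t) \<in> carrier M"
      using insert.prems by (intro M.finsum_closed) auto
    ultimately show ?case
      using insert by (auto simp: N_simps(3) simp flip: insert.IH)
  qed (simp add: N_simps)
  have "\<exists>d \<in> p ` S \<rightarrow> carrier R. u = (\<Oplus>\<^bsub>N\<^esub>t\<in>p ` S. d t \<odot>\<^bsub>N\<^esub> t)" if u: "u \<in> carrier N" for u
  proof -
    obtain x where x: "x \<in> carrier M" "u = p x" using u by (auto simp: N_simps)
    have injS: "inj_on p S" using inj S(2) by (rule inj_on_subset)
    have cS: "c x s \<in> carrier R" "s \<in> carrier M" if "s \<in> S" for s
      using c(1)[OF x(1)] S(2) that by auto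
    have "(\<Oplus>\<^bsub>N\<^esub>t\<in>p ` S. c x (q t) \<odot>\<^bsub>N\<^esub> t) = (\<Oplus>\<^bsub>N\<^esub>s\<in>S. c x (q (p s)) \<odot>\<^bsub>N\<^esub> p s)"
      using injS by (intro N.finsum_reindex) (auto simp: N_simps cS)
    also have "\<dots> = (\<Oplus>\<^bsub>N\<^esub>s\<in>S. p (c x s \<odot>\<^bsub>M\<^esub> s))"
      by (intro N.finsum_cong') (auto simp: N_simps cS)
    also have "\<dots> = p (\<Oplus>\<^bsub>M\<^esub>s\<in>S. c x s \<odot>\<^bsub>M\<^esub> s)"
      using S(1) cS by (intro p_sum[symmetric]) auto
    also have "\<dots> = u" using c(2)[OF x(1)] x(2) by simp
    finally show ?thesis
      using cS by (intro bexI[of _ "\<lambda>t. c x (q t)"]) auto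
  qed
  then have "finitely_generated R N"
    unfolding finitely_generated_def using S
    by (intro exI[of _ "p ` S"]) (auto simp: N_simps)
  then have "N \<in> fg_mod R" using lmN by (simp add: fg_mod_def)
  moreover have "restrict p (carrier M) \<in> module_iso R M N"
    using inj by (auto simp: module_iso_def Hom_def N_simps bij_betw_def)
  ultimately show ?thesis by (auto simp: isomorphic_def)
qed

end

theory Submission
  imports Defs
begin

text \<open>
  Suppose first that \<open>\<C>\<close> is a maximal chain of torsion classes all of which are brick-splitting,
  and let \<open>X \<rightarrow> Y\<close> be an arrow of a brick-cycle. A brick-splitting torsion class is closed under
  nonzero maps between bricks, so the members of \<open>\<C>\<close> contain either all bricks of the cycle or
  none of them. Let \<open>\<V>\<close> be the union of the latter members. The torsion class generated by
  \<open>\<V> \<union> {Y}\<close> is comparable with all of \<open>\<C>\<close>, hence lies in \<open>\<C>\<close> and contains \<open>X\<close>. Therefore \<open>Y\<close> maps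
  nontrivially to \<open>X\<close> and to the image of \<open>X \<rightarrow> Y\<close>, and since \<open>X\<close> and \<open>Y\<close> are bricks this makes
  \<open>X \<rightarrow> Y\<close> an isomorphism.

  Conversely, take a maximal chain \<open>\<C>\<close> among the brick-splitting torsion classes. If a torsion class
  \<open>\<T>\<close> is comparable with all of \<open>\<C>\<close> but not brick-splitting, there are bricks \<open>N \<in> \<T>\<close> and \<open>X \<notin> \<T>\<close>
  with a nonzero map \<open>N \<rightarrow> X\<close>; here \<open>N\<close> is a module in \<open>\<T>\<close> of least \<open>K\<close>-dimension that maps
  nontrivially to \<open>X\<close>. The union of the members of \<open>\<C>\<close> without \<open>X\<close>, together with all bricks reachable
  from \<open>X\<close> by nonzero maps, generates a brick-splitting torsion class in \<open>\<C>\<close> which contains \<open>X\<close>,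
  hence contains \<open>\<T>\<close> and in particular \<open>N\<close>. So \<open>N\<close> is reachable from \<open>X\<close>, which closes a brick-cycle.
\<close>

section \<open>Homomorphisms, submodules and spanning sets\<close>

lemma Hom_closed: "f \<in> Hom R M N \<Longrightarrow> x \<in> carrier M \<Longrightarrow> f x \<in> carrier N"
  by (auto simp: Hom_def)

lemma Hom_add:
  "f \<in> Hom R M N \<Longrightarrow> x \<in> carrier M \<Longrightarrow> y \<in> carrier M \<Longrightarrow> f (x \<oplus>\<^bsub>M\<^esub> y) = f x \<oplus>\<^bsub>N\<^esub> f y"
  by (auto simp: Hom_def)

lemma Hom_smult:
  "f \<in> Hom R M N \<Longrightarrow> a \<in> carrier R \<Longrightarrow> x \<in> carrier M \<Longrightarrow> f (a \<odot>\<^bsub>M\<^esub> x) = a \<odot>\<^bsub>N\<^esub> f x"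
  by (auto simp: Hom_def)

lemma Hom_compose:
  "left_module R M \<Longrightarrow> f \<in> Hom R M N \<Longrightarrow> g \<in> Hom R N P \<Longrightarrow> compose (carrier M) g f \<in> Hom R M P"
  by (auto simp: Hom_def PiE_iff compose_def left_module.smult_closed abelian_groupE(1) left_module.axioms(2))

lemma Hom_zero:
  assumes "left_module R M" "left_module R N" "f \<in> Hom R M N"
  shows "f \<zero>\<^bsub>M\<^esub> = \<zero>\<^bsub>N\<^esub>"
proof -
  interpret M: left_module R M by fact
  interpret N: left_module R N by fact
  have "f \<zero>\<^bsub>M\<^esub> \<oplus>\<^bsub>N\<^esub> f \<zero>\<^bsub>M\<^esub> = f \<zero>\<^bsub>M\<^esub>"
    using Hom_add[OF assms(3), of "\<zero>\<^bsub>M\<^esub>" "\<zero>\<^bsub>M\<^esub>"] by simp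
  then show ?thesis
    using Hom_closed[OF assms(3)] by (simp add: N.M.add.l_cancel_one)
qed

lemma Hom_eq_zero_iff:
  "f \<in> Hom R M N \<Longrightarrow> f = zero_hom M N \<longleftrightarrow> (\<forall>x \<in> carrier M. f x = \<zero>\<^bsub>N\<^esub>)"
  by (fastforce simp: Hom_def zero_hom_def PiE_iff extensional_def)

lemma zero_hom_Hom:
  assumes "left_module R M" "left_module R N"
  shows "zero_hom M N \<in> Hom R M N"
proof -
  interpret M: left_module R M by fact
  interpret N: left_module R N by fact
  show ?thesis
    by (auto simp: Hom_def zero_hom_def N.smult_zero_right)
qed

lemma Hom_eq_imp_zero_diff:
  assumes "left_module R M" "left_module R N" "f \<in> Hom R M N"
    and "x \<in> carrier M" "y \<in> carrier M" "f x = f y"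
  shows "f (x \<ominus>\<^bsub>M\<^esub> y) = \<zero>\<^bsub>N\<^esub>"
proof -
  interpret M: left_module R M by fact
  interpret N: left_module R N by fact
  have "f (x \<ominus>\<^bsub>M\<^esub> y) \<oplus>\<^bsub>N\<^esub> f y = f x"
    using assms Hom_add[OF assms(3), of "x \<ominus>\<^bsub>M\<^esub> y" y]
    by (simp add: M.M.minus_eq M.M.a_assoc M.M.l_neg)
  then show ?thesis
    using assms Hom_closed[OF assms(3)] by (simp add: N.M.add.r_cancel_one)
qed

lemma Hom_inj_on:
  assumes "left_module R M" "left_module R N" "f \<in> Hom R M N"
    and "\<And>x. x \<in> carrier M \<Longrightarrow> f x = \<zero>\<^bsub>N\<^esub> \<Longrightarrow> x = \<zero>\<^bsub>M\<^esub>"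
  shows "inj_on f (carrier M)"
proof (rule inj_onI)
  interpret M: left_module R M by fact
  fix x y assume xy: "x \<in> carrier M" "y \<in> carrier M" "f x = f y"
  then have "x \<ominus>\<^bsub>M\<^esub> y = \<zero>\<^bsub>M\<^esub>"
    using assms(4) Hom_eq_imp_zero_diff[OF assms(1-3)] by simp
  moreover have "(x \<ominus>\<^bsub>M\<^esub> y) \<oplus>\<^bsub>M\<^esub> y = x"
    using xy by (simp add: M.M.minus_eq M.M.a_assoc M.M.l_neg)
  ultimately show "x = y"
    using xy by simp
qed

text \<open>\<open>N\<close> is an arbitrary structure here, so closure of its carrier under the
  operations is transported from \<open>M\<close>: with \<open>g\<close> the inverse map, a sum of
  \<open>x\<close> and \<open>y\<close> in \<open>N\<close> is the image under \<open>f\<close> of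
  the sum of \<open>g x\<close> and \<open>g y\<close>.\<close>

lemma Hom_inverse:
  assumes "left_module R M" "f \<in> module_iso R M N"
  shows "(\<lambda>y \<in> carrier N. inv_into (carrier M) f y) \<in> module_iso R N M"
proof -
  interpret M: left_module R M by fact
  have f: "f \<in> Hom R M N" and bij: "bij_betw f (carrier M) (carrier N)"
    using assms(2) by (auto simp: module_iso_def)
  have inj: "inj_on f (carrier M)" and im: "f ` carrier M = carrier N"
    using bij by (auto simp: bij_betw_def)
  define g where "g = inv_into (carrier M) f"
  have gf: "g (f x) = x" if "x \<in> carrier M" for x
    using inj that by (simp add: g_def)
  have bg: "bij_betw g (carrier N) (carrier M)"
    unfolding g_def using bij by (rule bij_betw_inv_into)
  have gN: "g y \<in> carrier M" "f (g y) = y" if "y \<in> carrier N" for y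
    using that im by (auto simp: g_def inv_into_into f_inv_into_f)
  have fa: "f (g x \<oplus>\<^bsub>M\<^esub> g y) = x \<oplus>\<^bsub>N\<^esub> y" if "x \<in> carrier N" "y \<in> carrier N" for x y
    using that gN Hom_add[OF f] by simp
  have fs: "f (a \<odot>\<^bsub>M\<^esub> g x) = a \<odot>\<^bsub>N\<^esub> x" if "a \<in> carrier R" "x \<in> carrier N" for a x
    using that gN Hom_smult[OF f] by simp
  have "restrict g (carrier N) \<in> Hom R N M"
    unfolding Hom_def
  proof (intro CollectI conjI ballI)
    fix x y assume xy: "x \<in> carrier N" "y \<in> carrier N"
    have c: "g x \<oplus>\<^bsub>M\<^esub> g y \<in> carrier M" using xy gN by simp
    then have "x \<oplus>\<^bsub>N\<^esub> y \<in> carrier N" using Hom_closed[OF f c] fa[OF xy] by simp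
    then show "restrict g (carrier N) (x \<oplus>\<^bsub>N\<^esub> y) =
        restrict g (carrier N) x \<oplus>\<^bsub>M\<^esub> restrict g (carrier N) y"
      using xy gf[OF c] fa[OF xy] by simp
  next
    fix a x assume ax: "a \<in> carrier R" "x \<in> carrier N"
    have c: "a \<odot>\<^bsub>M\<^esub> g x \<in> carrier M" using ax gN by simp
    then have "a \<odot>\<^bsub>N\<^esub> x \<in> carrier N" using Hom_closed[OF f c] fs[OF ax] by simp
    then show "restrict g (carrier N) (a \<odot>\<^bsub>N\<^esub> x) = a \<odot>\<^bsub>M\<^esub> restrict g (carrier N) x"
      using ax gf[OF c] fs[OF ax] by simp
  qed (use gN in simp)
  then show ?thesis
    using bg by (simp add: module_iso_def g_def)
qed

section \<open>Submodules\<close>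

text \<open>Closure under negation is left to scalar multiplication by minus one, see
  \<open>submod_minus\<close>.\<close>

definition submod :: "('a, 'r) ring_scheme \<Rightarrow> ('a, 'b, 'm) module_scheme \<Rightarrow> 'b set \<Rightarrow> bool" where
  "submod R M H \<longleftrightarrow> H \<subseteq> carrier M \<and> \<zero>\<^bsub>M\<^esub> \<in> H \<and>
     (\<forall>x \<in> H. \<forall>y \<in> H. x \<oplus>\<^bsub>M\<^esub> y \<in> H) \<and> (\<forall>a \<in> carrier R. \<forall>x \<in> H. a \<odot>\<^bsub>M\<^esub> x \<in> H)"

lemma submodD:
  assumes "submod R M H"
  shows "x \<in> H \<Longrightarrow> x \<in> carrier M" "\<zero>\<^bsub>M\<^esub> \<in> H" "x \<in> H \<Longrightarrow> y \<in> H \<Longrightarrow> x \<oplus>\<^bsub>M\<^esub> y \<in> H"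
    "a \<in> carrier R \<Longrightarrow> x \<in> H \<Longrightarrow> a \<odot>\<^bsub>M\<^esub> x \<in> H"
  using assms by (auto simp: submod_def)

context left_module
begin

lemma smult_zero_left: "x \<in> carrier M \<Longrightarrow> \<zero> \<odot>\<^bsub>M\<^esub> x = \<zero>\<^bsub>M\<^esub>"
  using smult_l_distr[of \<zero> \<zero> x] by (simp add: M.add.l_cancel_one)

lemma smult_minus_one: "x \<in> carrier M \<Longrightarrow> (\<ominus> \<one>) \<odot>\<^bsub>M\<^esub> x = \<ominus>\<^bsub>M\<^esub> x"
  using smult_l_distr[of "\<ominus> \<one>" "\<one>" x] 
  by (intro M.minus_equality[symmetric]) (simp_all add: R.l_neg smult_zero_left)

lemma submod_minus: "submod R M H \<Longrightarrow> x \<in> H \<Longrightarrow> \<ominus>\<^bsub>M\<^esub> x \<in> H"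
  using smult_minus_one[of x] submodD(1)[of R M H x] submodD(4)[of R M H "\<ominus> \<one>" x] by simp

lemma submod_carrier: "submod R M (carrier M)"
  by (simp add: submod_def)

lemma submod_zero: "submod R M {\<zero>\<^bsub>M\<^esub>}"
  by (simp add: submod_def smult_zero_right)

lemma left_module_submod:
  assumes H: "submod R M H"
  shows "left_module R (M\<lparr>carrier := H\<rparr>)"
proof (intro left_module.intro left_module_axioms.intro R.ring_axioms abelian_groupI)
  fix x assume "x \<in> carrier (M\<lparr>carrier := H\<rparr>)"
  then show "\<exists>y \<in> carrier (M\<lparr>carrier := H\<rparr>).
      y \<oplus>\<^bsub>M\<lparr>carrier := H\<rparr>\<^esub> x = \<zero>\<^bsub>M\<lparr>carrier := H\<rparr>\<^esub>"
    using submod_minus[OF H] submodD[OF H] by (intro bexI[of _ "\<ominus>\<^bsub>M\<^esub> x"]) (auto simp: M.l_neg)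
qed (use submodD[OF H] in \<open>auto simp: M.a_ac smult_l_distr smult_r_distr smult_assoc\<close>)

end

lemma submod_image:
  assumes "left_module R M" "left_module R N" "f \<in> Hom R M N" "submod R M H"
  shows "submod R N (f ` H)"
proof -
  note D = submodD[OF assms(4)]
  show ?thesis
    unfolding submod_def
  proof (intro conjI ballI)
    show "f ` H \<subseteq> carrier N"
      using D Hom_closed[OF assms(3)] by blast
    show "\<zero>\<^bsub>N\<^esub> \<in> f ` H"
      using Hom_zero[OF assms(1-3), symmetric] D(2) by simp
    show "x \<oplus>\<^bsub>N\<^esub> y \<in> f ` H" if "x \<in> f ` H" "y \<in> f ` H" for x y
      using that D(3) Hom_add[OF assms(3) D(1) D(1), symmetric] by auto
    show "a \<odot>\<^bsub>N\<^esub> x \<in> f ` H" if "a \<in> carrier R" "x \<in> f ` H" for a x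
      using that D(4) Hom_smult[OF assms(3) _ D(1), symmetric] by auto
  qed
qed

section \<open>Generation by a given number of elements\<close>

text \<open>An inductive form of \<open>H is generated by n elements\<close>; over a field the least such \<open>n\<close> serves
  as the dimension of \<open>H\<close>.\<close>

inductive spanned ::
    "('a, 'r) ring_scheme \<Rightarrow> ('a, 'b, 'm) module_scheme \<Rightarrow> nat \<Rightarrow> 'b set \<Rightarrow> bool"
  for R M where
  spanned_0: "spanned R M 0 {\<zero>\<^bsub>M\<^esub>}"
| spanned_Suc: "spanned R M n H \<Longrightarrow> v \<in> carrier M \<Longrightarrow>
    spanned R M (Suc n) {a \<odot>\<^bsub>M\<^esub> v \<oplus>\<^bsub>M\<^esub> w | a w. a \<in> carrier R \<and> w \<in> H}"

context left_module
begin

lemma submod_insert: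
  assumes H: "submod R M H" and v: "v \<in> carrier M"
  shows "submod R M {a \<odot>\<^bsub>M\<^esub> v \<oplus>\<^bsub>M\<^esub> w | a w. a \<in> carrier R \<and> w \<in> H}" (is "submod R M ?G")
  unfolding submod_def
proof (intro conjI ballI)
  note D = submodD[OF H]
  show "?G \<subseteq> carrier M"
    using v D(1) by auto
  show "\<zero>\<^bsub>M\<^esub> \<in> ?G"
    using v D(2) smult_zero_left[OF v]
    by (intro CollectI exI[of _ \<zero>] exI[of _ "\<zero>\<^bsub>M\<^esub>"]) simp
  show "x \<oplus>\<^bsub>M\<^esub> y \<in> ?G" if xy: "x \<in> ?G" "y \<in> ?G" for x y
  proof -
    obtain a w b u where aw: "a \<in> carrier R" "w \<in> H" "x = a \<odot>\<^bsub>M\<^esub> v \<oplus>\<^bsub>M\<^esub> w"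
      and bu: "b \<in> carrier R" "u \<in> H" "y = b \<odot>\<^bsub>M\<^esub> v \<oplus>\<^bsub>M\<^esub> u"
      using xy by blast
    have "x \<oplus>\<^bsub>M\<^esub> y = (a \<oplus> b) \<odot>\<^bsub>M\<^esub> v \<oplus>\<^bsub>M\<^esub> (w \<oplus>\<^bsub>M\<^esub> u)"
      using aw bu v D(1) by (simp add: smult_l_distr M.a_ac)
    then show ?thesis
      using aw(1,2) bu(1,2) D(3) by blast
  qed
  show "b \<odot>\<^bsub>M\<^esub> x \<in> ?G" if b: "b \<in> carrier R" and x: "x \<in> ?G" for b x
  proof -
    obtain a w where aw: "a \<in> carrier R" "w \<in> H" "x = a \<odot>\<^bsub>M\<^esub> v \<oplus>\<^bsub>M\<^esub> w"
      using x by blast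
    have "b \<odot>\<^bsub>M\<^esub> x = (b \<otimes> a) \<odot>\<^bsub>M\<^esub> v \<oplus>\<^bsub>M\<^esub> b \<odot>\<^bsub>M\<^esub> w"
      using aw b v D(1) by (simp add: smult_r_distr smult_assoc)
    then show ?thesis
      using aw(1,2) b D(4) by blast
  qed
qed

lemma insert_span_supset:
  assumes "submod R M H" "v \<in> carrier M"
  shows "H \<subseteq> {a \<odot>\<^bsub>M\<^esub> v \<oplus>\<^bsub>M\<^esub> w | a w. a \<in> carrier R \<and> w \<in> H}"
proof
  fix x assume "x \<in> H"
  then show "x \<in> {a \<odot>\<^bsub>M\<^esub> v \<oplus>\<^bsub>M\<^esub> w | a w. a \<in> carrier R \<and> w \<in> H}"
    using smult_zero_left[OF assms(2)] submodD(1)[OF assms(1)]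
    by (intro CollectI exI[of _ \<zero>] exI[of _ x]) simp
qed

lemma spanned_submod: "spanned R M n H \<Longrightarrow> submod R M H"
  by (induction rule: spanned.induct) (auto simp: submod_zero intro: submod_insert)

text \<open>Both directions add one generator at a time: forwards by induction on the finite
  generating set, backwards by induction on the derivation of \<open>spanned\<close>, whose vectors
  are collected into a set.\<close>

lemma finitely_generated_iff_spanned:
  "finitely_generated R M \<longleftrightarrow> (\<exists>n. spanned R M n (carrier M))"
proof
  have *: "spanned R M (card S) {\<Oplus>\<^bsub>M\<^esub>s\<in>S. c s \<odot>\<^bsub>M\<^esub> s | c. c \<in> S \<rightarrow> carrier R}"
    if "finite S" "S \<subseteq> carrier M" for S
    using that
  proof (induction S)
    case empty
    show ?case
      using spanned_0[of R M] by simp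
  next
    case (insert v S)
    let ?H = "{\<Oplus>\<^bsub>M\<^esub>s\<in>S. c s \<odot>\<^bsub>M\<^esub> s | c. c \<in> S \<rightarrow> carrier R}"
    have v: "v \<in> carrier M" "S \<subseteq> carrier M" using insert.prems by auto
    have ins: "(\<Oplus>\<^bsub>M\<^esub>s\<in>insert v S. c s \<odot>\<^bsub>M\<^esub> s) = c v \<odot>\<^bsub>M\<^esub> v \<oplus>\<^bsub>M\<^esub> (\<Oplus>\<^bsub>M\<^esub>s\<in>S. c s \<odot>\<^bsub>M\<^esub> s)"
      if "c \<in> insert v S \<rightarrow> carrier R" for c
      using insert.hyps v that by (intro M.finsum_insert) auto
    have "{\<Oplus>\<^bsub>M\<^esub>s\<in>insert v S. c s \<odot>\<^bsub>M\<^esub> s | c. c \<in> insert v S \<rightarrow> carrier R} =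
        {a \<odot>\<^bsub>M\<^esub> v \<oplus>\<^bsub>M\<^esub> w | a w. a \<in> carrier R \<and> w \<in> ?H}" (is "?L = ?G")
    proof (intro subset_antisym subsetI)
      fix x assume "x \<in> ?L"
      then obtain c where c: "c \<in> insert v S \<rightarrow> carrier R"
        "x = (\<Oplus>\<^bsub>M\<^esub>s\<in>insert v S. c s \<odot>\<^bsub>M\<^esub> s)" by blast
      moreover have "c \<in> S \<rightarrow> carrier R" "c v \<in> carrier R" using c(1) by auto
      ultimately show "x \<in> ?G" using ins[OF c(1)] by blast
    next
      fix x assume "x \<in> ?G"
      then obtain a c where c: "a \<in> carrier R" "c \<in> S \<rightarrow> carrier R"
        "x = a \<odot>\<^bsub>M\<^esub> v \<oplus>\<^bsub>M\<^esub> (\<Oplus>\<^bsub>M\<^esub>s\<in>S. c s \<odot>\<^bsub>M\<^esub> s)" by blast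
      have c': "c(v := a) \<in> insert v S \<rightarrow> carrier R" using c by auto
      have "(\<Oplus>\<^bsub>M\<^esub>s\<in>S. (c(v := a)) s \<odot>\<^bsub>M\<^esub> s) = (\<Oplus>\<^bsub>M\<^esub>s\<in>S. c s \<odot>\<^bsub>M\<^esub> s)"
        using insert.hyps v c(2) by (intro M.finsum_cong') auto
      then have "x = (\<Oplus>\<^bsub>M\<^esub>s\<in>insert v S. (c(v := a)) s \<odot>\<^bsub>M\<^esub> s)"
        using ins[OF c'] c(3) by simp
      then show "x \<in> ?L" using c' by blast
    qed
    then show ?case
      using spanned_Suc[OF insert.IH[OF v(2)] v(1)] insert.hyps by simp
  qed
  assume "finitely_generated R M"
  then obtain S where S: "finite S" "S \<subseteq> carrier M"
    and gen: "\<And>x. x \<in> carrier M \<Longrightarrow> \<exists>c \<in> S \<rightarrow> carrier R. x = (\<Oplus>\<^bsub>M\<^esub>s\<in>S. c s \<odot>\<^bsub>M\<^esub> s)"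
    unfolding finitely_generated_def by blast
  have "{\<Oplus>\<^bsub>M\<^esub>s\<in>S. c s \<odot>\<^bsub>M\<^esub> s | c. c \<in> S \<rightarrow> carrier R} = carrier M"
    using gen submodD(1)[OF spanned_submod[OF *[OF S]]] by blast
  then show "\<exists>n. spanned R M n (carrier M)"
    using *[OF S] by metis
next
  have *: "\<exists>S. finite S \<and> S \<subseteq> H \<and> (\<forall>x \<in> H. \<exists>c \<in> S \<rightarrow> carrier R. x = (\<Oplus>\<^bsub>M\<^esub>s\<in>S. c s \<odot>\<^bsub>M\<^esub> s))"
    if "spanned R M n H" for n H
    using that
  proof (induction rule: spanned.induct)
    case spanned_0
    show ?case by (intro exI[of _ "{}"]) simp
  next
    case (spanned_Suc n H v)
    let ?G = "{a \<odot>\<^bsub>M\<^esub> v \<oplus>\<^bsub>M\<^esub> w | a w. a \<in> carrier R \<and> w \<in> H}"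
    note D = submodD[OF spanned_submod[OF spanned_Suc.hyps(1)]]
    obtain S where S: "finite S" "S \<subseteq> H"
      and gen: "\<And>x. x \<in> H \<Longrightarrow> \<exists>c \<in> S \<rightarrow> carrier R. x = (\<Oplus>\<^bsub>M\<^esub>s\<in>S. c s \<odot>\<^bsub>M\<^esub> s)"
      using spanned_Suc.IH by blast
    have HG: "H \<subseteq> ?G"
      by (rule insert_span_supset[OF spanned_submod[OF spanned_Suc.hyps(1)] spanned_Suc.hyps(2)])
    show ?case
    \<comment> \<open>A vector already in \<open>H\<close> adds nothing to the span. Otherwise
      \<open>v\<close> is not in \<open>S\<close>, so the coefficient at \<open>v\<close> can be set
      to \<open>a\<close> without disturbing the sum that represents \<open>w\<close>.\<close>
    proof (cases "v \<in> H")
      case True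
      then have "?G = H" using D(3,4) HG by blast
      then show ?thesis using S gen by (intro exI[of _ S]) simp
    next
      case False
      have "v \<in> ?G"
        using spanned_Suc.hyps(2) D(2) by (intro CollectI exI[of _ \<one>] exI[of _ "\<zero>\<^bsub>M\<^esub>"]) simp
      moreover have "\<exists>c \<in> insert v S \<rightarrow> carrier R. x = (\<Oplus>\<^bsub>M\<^esub>s\<in>insert v S. c s \<odot>\<^bsub>M\<^esub> s)"
        if x: "x \<in> ?G" for x
      proof -
        obtain a w where aw: "a \<in> carrier R" "w \<in> H" "x = a \<odot>\<^bsub>M\<^esub> v \<oplus>\<^bsub>M\<^esub> w"
          using x by blast
        obtain c where c: "c \<in> S \<rightarrow> carrier R" "w = (\<Oplus>\<^bsub>M\<^esub>s\<in>S. c s \<odot>\<^bsub>M\<^esub> s)"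
          using gen[OF aw(2)] by blast
        have vS: "v \<notin> S" and SM: "S \<subseteq> carrier M" using False S(2) D(1) by auto
        have cS: "c s \<odot>\<^bsub>M\<^esub> s \<in> carrier M" if "s \<in> S" for s
          using that c(1) SM by (intro smult_closed) auto
        have "(\<Oplus>\<^bsub>M\<^esub>s\<in>insert v S. (c(v := a)) s \<odot>\<^bsub>M\<^esub> s) =
            (c(v := a)) v \<odot>\<^bsub>M\<^esub> v \<oplus>\<^bsub>M\<^esub> (\<Oplus>\<^bsub>M\<^esub>s\<in>S. (c(v := a)) s \<odot>\<^bsub>M\<^esub> s)"
          using S(1) vS cS aw(1) spanned_Suc.hyps(2) by (intro M.finsum_insert) auto
        also have "(\<Oplus>\<^bsub>M\<^esub>s\<in>S. (c(v := a)) s \<odot>\<^bsub>M\<^esub> s) = w"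
          unfolding c(2) using vS cS by (intro M.finsum_cong') auto
        finally show ?thesis
          using aw c(1) by (intro bexI[of _ "c(v := a)"]) auto
      qed
      ultimately show ?thesis
        using S HG by (intro exI[of _ "insert v S"]) (simp add: subset_iff)
    qed
  qed
  assume "\<exists>n. spanned R M n (carrier M)"
  then show "finitely_generated R M"
    using * unfolding finitely_generated_def by blast
qed

lemma spanned_submod_restrict:
  "spanned R M n H \<Longrightarrow> submod R M P \<Longrightarrow> H \<subseteq> P \<Longrightarrow> spanned R (M\<lparr>carrier := P\<rparr>) n H"
proof (induction rule: spanned.induct)
  case spanned_0
  show ?case using spanned.spanned_0[of R "M\<lparr>carrier := P\<rparr>"] by simp
next
  case (spanned_Suc n H v)
  note D = submodD[OF spanned_submod[OF spanned_Suc.hyps(1)]]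
  \<comment> \<open>The coefficients 0 and 1 recover the elements of \<open>H\<close> and the vector
    \<open>v\<close> from the enlarged span, so the whole derivation takes place inside
    \<open>P\<close>.\<close>
  have "H \<subseteq> P"
  proof
    fix x assume "x \<in> H"
    then have "\<zero> \<odot>\<^bsub>M\<^esub> v \<oplus>\<^bsub>M\<^esub> x \<in> P" using spanned_Suc.prems(2) by blast
    then show "x \<in> P" using \<open>x \<in> H\<close> spanned_Suc.hyps(2) D(1) by (simp add: smult_zero_left)
  qed
  moreover have "v \<in> P"
  proof -
    have "\<one> \<odot>\<^bsub>M\<^esub> v \<oplus>\<^bsub>M\<^esub> \<zero>\<^bsub>M\<^esub> \<in> P" using spanned_Suc.prems(2) D(2) by blast
    then show ?thesis using spanned_Suc.hyps(2) by simp
  qed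
  ultimately show ?case
    using spanned.spanned_Suc[of R "M\<lparr>carrier := P\<rparr>" n H v] spanned_Suc by simp
qed

text \<open>This bounds the dimension of an \<open>A\<close>-module over the ground field by summing
  the contributions of its \<open>A\<close>-generators.\<close>

lemma spanned_add:
  assumes "spanned R M n G" "spanned R M m H"
  shows "spanned R M (n + m) {g \<oplus>\<^bsub>M\<^esub> h | g h. g \<in> G \<and> h \<in> H}"
  using assms(1)
proof (induction rule: spanned.induct)
  note D = submodD[OF spanned_submod[OF assms(2)]]
  case spanned_0
  have "{g \<oplus>\<^bsub>M\<^esub> h | g h. g \<in> {\<zero>\<^bsub>M\<^esub>} \<and> h \<in> H} = H"
    using D(1) by force
  then show ?case using assms(2) by simp
next
  case (spanned_Suc n G v)
  note D = submodD[OF spanned_submod[OF assms(2)]] 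
  note E = submodD[OF spanned_submod[OF spanned_Suc.hyps(1)]]
  let ?S = "{g \<oplus>\<^bsub>M\<^esub> h | g h. g \<in> G \<and> h \<in> H}"
  let ?G = "{a \<odot>\<^bsub>M\<^esub> v \<oplus>\<^bsub>M\<^esub> w | a w. a \<in> carrier R \<and> w \<in> G}"
  have eq: "(a \<odot>\<^bsub>M\<^esub> v \<oplus>\<^bsub>M\<^esub> w) \<oplus>\<^bsub>M\<^esub> h = a \<odot>\<^bsub>M\<^esub> v \<oplus>\<^bsub>M\<^esub> (w \<oplus>\<^bsub>M\<^esub> h)"
    if "a \<in> carrier R" "w \<in> G" "h \<in> H" for a w h
    using that spanned_Suc.hyps(2) D(1) E(1) by (simp add: M.a_assoc)
  have "{g \<oplus>\<^bsub>M\<^esub> h | g h. g \<in> ?G \<and> h \<in> H} = {a \<odot>\<^bsub>M\<^esub> v \<oplus>\<^bsub>M\<^esub> w | a w. a \<in> carrier R \<and> w \<in> ?S}"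
    (is "?L = ?T")
  proof (intro subset_antisym subsetI)
    fix x assume "x \<in> ?L"
    then obtain a w h where x: "a \<in> carrier R" "w \<in> G" "h \<in> H"
        "x = a \<odot>\<^bsub>M\<^esub> v \<oplus>\<^bsub>M\<^esub> w \<oplus>\<^bsub>M\<^esub> h"
      by auto
    moreover have "w \<oplus>\<^bsub>M\<^esub> h \<in> ?S" using x by auto
    moreover have "x = a \<odot>\<^bsub>M\<^esub> v \<oplus>\<^bsub>M\<^esub> (w \<oplus>\<^bsub>M\<^esub> h)" using eq x by simp
    ultimately show "x \<in> ?T" by blast
  next
    fix x assume "x \<in> ?T"
    then obtain a w h where x: "a \<in> carrier R" "w \<in> G" "h \<in> H"
        "x = a \<odot>\<^bsub>M\<^esub> v \<oplus>\<^bsub>M\<^esub> (w \<oplus>\<^bsub>M\<^esub> h)"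
      by auto
    moreover have "a \<odot>\<^bsub>M\<^esub> v \<oplus>\<^bsub>M\<^esub> w \<in> ?G" using x by auto
    moreover have "x = a \<odot>\<^bsub>M\<^esub> v \<oplus>\<^bsub>M\<^esub> w \<oplus>\<^bsub>M\<^esub> h" using eq x by simp
    ultimately show "x \<in> ?L" by blast
  qed
  then show ?case
    using spanned.spanned_Suc[OF spanned_Suc.IH spanned_Suc.hyps(2)] by simp
qed

end

lemma image_insert_span:
  assumes "left_module R M" "f \<in> Hom R M N" "submod R M H" "v \<in> carrier M"
  shows "f ` {a \<odot>\<^bsub>M\<^esub> v \<oplus>\<^bsub>M\<^esub> w | a w. a \<in> carrier R \<and> w \<in> H} =
    {a \<odot>\<^bsub>N\<^esub> f v \<oplus>\<^bsub>N\<^esub> w | a w. a \<in> carrier R \<and> w \<in> f ` H}"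
proof -
  interpret M: left_module R M by fact
  have "f (a \<odot>\<^bsub>M\<^esub> v \<oplus>\<^bsub>M\<^esub> w) = a \<odot>\<^bsub>N\<^esub> f v \<oplus>\<^bsub>N\<^esub> f w" if "a \<in> carrier R" "w \<in> H" for a w
    using that assms(4) submodD(1)[OF assms(3)] by (simp add: Hom_add[OF assms(2)] Hom_smult[OF assms(2)])
  then show ?thesis
    by (fastforce simp: image_iff)
qed

lemma spanned_image:
  assumes "left_module R M" "left_module R N" "f \<in> Hom R M N" "spanned R M n H"
  shows "spanned R N n (f ` H)"
  using assms(4)
proof (induction rule: spanned.induct)
  case spanned_0
  show ?case using spanned.spanned_0[of R N] by (simp add: Hom_zero[OF assms(1-3)])
next
  case (spanned_Suc n H v)
  show ?case
    using spanned.spanned_Suc[OF spanned_Suc.IH Hom_closed[OF assms(3) spanned_Suc.hyps(2)]]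
      image_insert_span[OF assms(1,3) left_module.spanned_submod[OF assms(1) spanned_Suc.hyps(1)]
        spanned_Suc.hyps(2)]
    by simp
qed

lemma finitely_generated_image:
  assumes "left_module R M" "left_module R N" "f \<in> Hom R M N" "f ` carrier M = carrier N"
    and "finitely_generated R M"
  shows "finitely_generated R N"
  using assms(4,5) spanned_image[OF assms(1-3), of _ "carrier M"]
  by (auto simp: left_module.finitely_generated_iff_spanned[OF assms(1)]
      left_module.finitely_generated_iff_spanned[OF assms(2)])

section \<open>Images of homomorphisms as modules\<close>

text \<open>The image keeps the operations and the element type of \<open>N\<close>, so it can be an
  object of \<open>fg_mod\<close> and its inclusion into \<open>N\<close> is a restricted
  identity.\<close>

definition image_module ::
    "('a, 'b, 'l) module_scheme \<Rightarrow> ('a, 'c, 'm) module_scheme \<Rightarrow> ('b \<Rightarrow> 'c) \<Rightarrow> ('a, 'c, 'm) module_scheme" where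
  "image_module M N f = N\<lparr>carrier := f ` carrier M\<rparr>"

lemma Hom_image_module:
  "f \<in> Hom R M N \<Longrightarrow> f \<in> Hom R M (image_module M N f)"
  by (auto simp: Hom_def image_module_def)

lemma Hom_restrict:
  "submod R N H \<Longrightarrow> g \<in> Hom R N P \<Longrightarrow> restrict g H \<in> Hom R (N\<lparr>carrier := H\<rparr>) P"
  by (auto simp: Hom_def PiE_iff submod_def subset_iff)

lemma Hom_image_restrict:
  assumes "left_module R M" "left_module R N" "f \<in> Hom R M N" "g \<in> Hom R N P"
  shows "restrict g (f ` carrier M) \<in> Hom R (image_module M N f) P"
  unfolding image_module_def
  by (intro Hom_restrict submod_image[OF assms(1-3)] left_module.submod_carrier assms)

text \<open>Submodules of finitely generated modules need not be finitely generated over a general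
  ring; an image is, being a quotient of \<open>M\<close>.\<close>

lemma image_module_fg:
  assumes "M \<in> fg_mod R" "N \<in> fg_mod R" "f \<in> Hom R M N"
  shows "image_module M N f \<in> fg_mod R"
proof -
  have lm: "left_module R M" "left_module R N" and fg: "finitely_generated R M"
    using assms by (auto simp: fg_mod_def)
  have im: "left_module R (image_module M N f)"
    unfolding image_module_def
    by (intro left_module.left_module_submod submod_image[OF lm assms(3)]
        left_module.submod_carrier lm)
  have "finitely_generated R (image_module M N f)"
    by (rule finitely_generated_image[OF lm(1) im Hom_image_module[OF assms(3)] _ fg])
      (simp add: image_module_def)
  then show ?thesis
    using im by (simp add: fg_mod_def)
qed

section \<open>Dimension counts over a field\<close>

context left_module
begin

lemma smult_minus_left: "a \<in> carrier R \<Longrightarrow> x \<in> carrier M \<Longrightarrow> (\<ominus> a) \<odot>\<^bsub>M\<^esub> x = \<ominus>\<^bsub>M\<^esub> (a \<odot>\<^bsub>M\<^esub> x)"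
  using smult_l_distr[of "\<ominus> a" a x]
  by (intro M.minus_equality[symmetric]) (simp_all add: R.l_neg smult_zero_left)

text \<open>The exchange step of both dimension counts below: a vector is recovered from a
  combination in which its coefficient is invertible.\<close>

lemma solve_smult:
  assumes "field R" "a \<in> carrier R" "a \<noteq> \<zero>" "v \<in> carrier M" "w \<in> carrier M"
  shows "v = inv a \<odot>\<^bsub>M\<^esub> (a \<odot>\<^bsub>M\<^esub> v \<oplus>\<^bsub>M\<^esub> w) \<oplus>\<^bsub>M\<^esub> (\<ominus> (inv a)) \<odot>\<^bsub>M\<^esub> w"
proof -
  interpret F: field R by fact
  have i: "inv a \<in> carrier R" "inv a \<otimes> a = \<one>"
    using assms(2,3) F.field_Units by auto
  have "inv a \<odot>\<^bsub>M\<^esub> (a \<odot>\<^bsub>M\<^esub> v \<oplus>\<^bsub>M\<^esub> w) = v \<oplus>\<^bsub>M\<^esub> inv a \<odot>\<^bsub>M\<^esub> w"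
    using assms i smult_assoc[of "inv a" a v] by (simp add: smult_r_distr)
  then show ?thesis
    using assms i by (simp add: smult_minus_left M.a_assoc M.r_neg)
qed

text \<open>Monotonicity of dimension, strict for proper subspaces. The induction hypothesis handles
  the intersection of \<open>H\<close> with \<open>G\<close>; if \<open>H\<close> is not inside
  \<open>G\<close>, a single \<open>h\<close> outside \<open>G\<close> can replace \<open>v\<close>
  and generates \<open>H\<close> over that intersection.\<close>

lemma spanned_submod_less:
  assumes "field R" "spanned R M n G" "submod R M H" "H \<subseteq> G"
  shows "\<exists>m \<le> n. spanned R M m H \<and> (m = n \<longrightarrow> H = G)"
  using assms(2-4)
proof (induction arbitrary: H rule: spanned.induct)
  case spanned_0
  then have "H = {\<zero>\<^bsub>M\<^esub>}" using submodD(2) by blast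
  then show ?case using spanned.spanned_0 by blast
next
  case (spanned_Suc n G v)
  interpret F: field R by fact
  note v = spanned_Suc.hyps(2)
  have G: "submod R M G" using spanned_submod[OF spanned_Suc.hyps(1)] .
  note DG = submodD[OF G] and DH = submodD[OF spanned_Suc.prems(1)]
  have HG: "submod R M (H \<inter> G)"
    using DG DH by (simp add: submod_def subset_iff)
  obtain m where m: "m \<le> n" "spanned R M m (H \<inter> G)" "m = n \<Longrightarrow> H \<inter> G = G"
    using spanned_Suc.IH[OF HG] by auto
  show ?case
  proof (cases "H \<subseteq> G")
    case True
    then have "H \<inter> G = H" by blast
    then show ?thesis using m by (intro exI[of _ m]) simp
  next
    case False
    then obtain h where h: "h \<in> H" "h \<notin> G" by blast
    then obtain a w where aw: "a \<in> carrier R" "w \<in> G" "h = a \<odot>\<^bsub>M\<^esub> v \<oplus>\<^bsub>M\<^esub> w"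
      using spanned_Suc.prems(2) by blast
    have a0: "a \<noteq> \<zero>"
      using h(2) aw v DG(1) by (auto simp: smult_zero_left)
    have ia: "inv a \<in> carrier R" using aw(1) a0 F.field_Units by auto
    have v_eq: "v = inv a \<odot>\<^bsub>M\<^esub> h \<oplus>\<^bsub>M\<^esub> (\<ominus> (inv a)) \<odot>\<^bsub>M\<^esub> w"
      unfolding aw(3) using solve_smult[OF assms(1) aw(1) a0 v] DG(1)[OF aw(2)] by simp
    let ?H = "{c \<odot>\<^bsub>M\<^esub> h \<oplus>\<^bsub>M\<^esub> u | c u. c \<in> carrier R \<and> u \<in> H \<inter> G}"
    have hM: "h \<in> carrier M" using h DH(1) by blast
    have "H = ?H"
    proof (intro subset_antisym subsetI)
      fix x assume x: "x \<in> H"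
      then obtain b u where bu: "b \<in> carrier R" "u \<in> G" "x = b \<odot>\<^bsub>M\<^esub> v \<oplus>\<^bsub>M\<^esub> u"
        using spanned_Suc.prems(2) by blast
      \<comment> \<open>Substituting \<open>v_eq\<close> for \<open>v\<close> in \<open>x\<close>
        leaves a multiple of \<open>h\<close> and a remainder \<open>y\<close> in \<open>G\<close>.
        As a difference of \<open>x\<close> and a multiple of \<open>h\<close>, the remainder also
        lies in \<open>H\<close>.\<close>
      define c where "c = b \<otimes> inv a"
      define y where "y = (b \<otimes> (\<ominus> (inv a))) \<odot>\<^bsub>M\<^esub> w \<oplus>\<^bsub>M\<^esub> u"
      have c: "c \<in> carrier R" using bu ia by (simp add: c_def)
      have y: "y \<in> G" using bu ia aw DG(3,4) by (simp add: y_def)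
      have "b \<odot>\<^bsub>M\<^esub> v = c \<odot>\<^bsub>M\<^esub> h \<oplus>\<^bsub>M\<^esub> (b \<otimes> (\<ominus> (inv a))) \<odot>\<^bsub>M\<^esub> w"
        by (subst v_eq) (use bu ia hM DG(1)[OF aw(2)] in \<open>simp add: c_def smult_r_distr smult_assoc\<close>)
      then have xe: "x = c \<odot>\<^bsub>M\<^esub> h \<oplus>\<^bsub>M\<^esub> y"
        using bu ia c hM DG(1)[OF aw(2)] DG(1)[OF bu(2)] by (simp add: y_def M.a_assoc)
      have "(\<ominus> c) \<odot>\<^bsub>M\<^esub> h \<oplus>\<^bsub>M\<^esub> x = y"
        using c hM DG(1)[OF y] by (simp add: xe smult_minus_left M.r_neg1)
      moreover have "(\<ominus> c) \<odot>\<^bsub>M\<^esub> h \<oplus>\<^bsub>M\<^esub> x \<in> H"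
        using c h x DH(3,4) by simp
      ultimately show "x \<in> ?H" using xe c y by blast
    next
      fix x assume "x \<in> ?H"
      then show "x \<in> H" using h DH(3,4) by blast
    qed
    moreover have "spanned R M (Suc m) ?H"
      using spanned.spanned_Suc[OF m(2) hM] .
    \<comment> \<open>Equality of the counts puts \<open>G\<close> inside \<open>H\<close> by
      induction, and then \<open>v_eq\<close> puts \<open>v\<close> into \<open>H\<close> as
      well.\<close>
    moreover have "H = {a \<odot>\<^bsub>M\<^esub> v \<oplus>\<^bsub>M\<^esub> w | a w. a \<in> carrier R \<and> w \<in> G}" if "Suc m = Suc n"
    proof -
      have GH: "G \<subseteq> H" using m(3) that by blast
      have "inv a \<odot>\<^bsub>M\<^esub> h \<oplus>\<^bsub>M\<^esub> (\<ominus> (inv a)) \<odot>\<^bsub>M\<^esub> w \<in> H"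
        using ia h aw(2) GH by (intro DH(3) DH(4)) auto
      then have "v \<in> H" using v_eq by simp
      then have "{a \<odot>\<^bsub>M\<^esub> v \<oplus>\<^bsub>M\<^esub> w | a w. a \<in> carrier R \<and> w \<in> G} \<subseteq> H"
        using GH DH(3,4) by blast
      then show ?thesis using spanned_Suc.prems(2) by blast
    qed
    ultimately show ?thesis
      using m(1) by (intro exI[of _ "Suc m"]) simp
  qed
qed

end

text \<open>A weak form of rank-nullity: a nonzero kernel element is a linear relation between the
  images of the generators, which makes one of them redundant.\<close>

lemma spanned_image_less:
  assumes "field R" "left_module R M" "left_module R N" "f \<in> Hom R M N" "spanned R M n G"
    and "x \<in> G" "x \<noteq> \<zero>\<^bsub>M\<^esub>" "f x = \<zero>\<^bsub>N\<^esub>"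
  shows "\<exists>m < n. spanned R N m (f ` G)"
  using assms(5-8)
proof (induction arbitrary: x rule: spanned.induct)
  case spanned_0
  then show ?case by simp
next
  case (spanned_Suc n G v)
  interpret F: field R by fact
  interpret M: left_module R M by fact
  interpret N: left_module R N by fact
  note v = spanned_Suc.hyps(2)
  have G: "submod R M G" using M.spanned_submod[OF spanned_Suc.hyps(1)] .
  note DG = submodD[OF G] and DI = submodD[OF submod_image[OF assms(2-4) G]]
  let ?G = "{a \<odot>\<^bsub>M\<^esub> v \<oplus>\<^bsub>M\<^esub> w | a w. a \<in> carrier R \<and> w \<in> G}"
  have im: "f ` ?G = {a \<odot>\<^bsub>N\<^esub> f v \<oplus>\<^bsub>N\<^esub> w | a w. a \<in> carrier R \<and> w \<in> f ` G}"
    by (rule image_insert_span[OF assms(2,4) G v])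
  obtain a w where aw: "a \<in> carrier R" "w \<in> G" "x = a \<odot>\<^bsub>M\<^esub> v \<oplus>\<^bsub>M\<^esub> w"
    using spanned_Suc.prems(1) by blast
  have fv: "f v \<in> carrier N" using Hom_closed[OF assms(4) v] .
  show ?case
  \<comment> \<open>If the last generator does not occur in \<open>x\<close>, the saving comes from
    the earlier ones by induction. Otherwise \<open>f x\<close> being zero expresses
    \<open>f v\<close> through the image of \<open>G\<close>.\<close>
  proof (cases "a = \<zero>\<^bsub>R\<^esub>")
    case True
    then have "x = w" using aw v DG(1) by (simp add: M.smult_zero_left)
    then obtain m where "m < n" "spanned R N m (f ` G)"
      using spanned_Suc.IH[of x] spanned_Suc.prems aw(2) by auto
    then show ?thesis
      unfolding im using spanned.spanned_Suc[OF _ fv] by (intro exI[of _ "Suc m"]) simp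
  next
    case False
    have ia: "inv\<^bsub>R\<^esub> a \<in> carrier R" using aw(1) False F.field_Units by auto
    have w: "w \<in> carrier M" and fw: "f w \<in> carrier N"
      using DG(1)[OF aw(2)] Hom_closed[OF assms(4)] by auto
    have "f x = a \<odot>\<^bsub>N\<^esub> f v \<oplus>\<^bsub>N\<^esub> f w"
      using aw v w by (simp add: Hom_add[OF assms(4)] Hom_smult[OF assms(4)])
    then have "f v = inv\<^bsub>R\<^esub> a \<odot>\<^bsub>N\<^esub> f x \<oplus>\<^bsub>N\<^esub> (\<ominus>\<^bsub>R\<^esub> (inv\<^bsub>R\<^esub> a)) \<odot>\<^bsub>N\<^esub> f w"
      using N.solve_smult[OF assms(1) aw(1) False fv fw] by simp
    then have "f v = (\<ominus>\<^bsub>R\<^esub> (inv\<^bsub>R\<^esub> a)) \<odot>\<^bsub>N\<^esub> f w"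
      using spanned_Suc.prems(3) ia fw by (simp add: N.smult_zero_right)
    then have "f v \<in> f ` G"
      using DI(4) ia aw(2) by simp
    then have "f ` ?G \<subseteq> f ` G"
      unfolding im using DI(3,4) by blast
    moreover have "f ` G \<subseteq> f ` ?G"
      using M.insert_span_supset[OF G v] by (rule image_mono)
    ultimately have "f ` ?G = f ` G" by blast
    then show ?thesis
      using spanned_image[OF assms(2-4) spanned_Suc.hyps(1)] by (intro exI[of _ n]) simp
  qed
qed

section \<open>Modules over finite-dimensional algebras and bricks\<close>

text \<open>The underlying vector space of an \<open>A\<close>-module, on which dimensions are
  counted; the ring multiplication and unit are dummy fields.\<close>

definition restrict_scalars ::
    "('k, 'r) ring_scheme \<Rightarrow> ('k, 'a, 's) module_scheme \<Rightarrow> ('a, 'b, 'm) module_scheme \<Rightarrow> ('k, 'b) module"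
  where
  "restrict_scalars K A M =
     \<lparr>carrier = carrier M, monoid.mult = undefined, monoid.one = undefined,
      ring.zero = \<zero>\<^bsub>M\<^esub>, ring.add = ring.add M,
      smult = (\<lambda>c x. (c \<odot>\<^bsub>A\<^esub> \<one>\<^bsub>A\<^esub>) \<odot>\<^bsub>M\<^esub> x)\<rparr>"

lemma restrict_scalars_simps [simp]:
  "carrier (restrict_scalars K A M) = carrier M"
  "\<zero>\<^bsub>restrict_scalars K A M\<^esub> = \<zero>\<^bsub>M\<^esub>"
  "x \<oplus>\<^bsub>restrict_scalars K A M\<^esub> y = x \<oplus>\<^bsub>M\<^esub> y"
  "c \<odot>\<^bsub>restrict_scalars K A M\<^esub> x = (c \<odot>\<^bsub>A\<^esub> \<one>\<^bsub>A\<^esub>) \<odot>\<^bsub>M\<^esub> x"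
  by (simp_all add: restrict_scalars_def)

lemma restrict_scalars_submod:
  "restrict_scalars K A (M\<lparr>carrier := H\<rparr>) = (restrict_scalars K A M)\<lparr>carrier := H\<rparr>"
  by (simp add: restrict_scalars_def)

context fin_dim_algebra
begin

lemma left_module_self: "left_module K A"
proof (intro left_module.intro left_module_axioms.intro)
  show "ring K" "abelian_group A"
    by (rule R.ring_axioms, rule M.abelian_group_axioms)
qed (simp_all add: smult_l_distr smult_r_distr smult_assoc1)

lemma smult_one_mult:
  "c \<in> carrier K \<Longrightarrow> x \<in> carrier A \<Longrightarrow> (c \<odot>\<^bsub>A\<^esub> \<one>\<^bsub>A\<^esub>) \<otimes>\<^bsub>A\<^esub> x = c \<odot>\<^bsub>A\<^esub> x"
  by (simp add: smult_mult_left)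

lemma smult_one_smult_one:
  "c \<in> carrier K \<Longrightarrow> d \<in> carrier K \<Longrightarrow>
    (c \<otimes>\<^bsub>K\<^esub> d) \<odot>\<^bsub>A\<^esub> \<one>\<^bsub>A\<^esub> = (c \<odot>\<^bsub>A\<^esub> \<one>\<^bsub>A\<^esub>) \<otimes>\<^bsub>A\<^esub> (d \<odot>\<^bsub>A\<^esub> \<one>\<^bsub>A\<^esub>)"
  by (simp add: smult_one_mult smult_assoc1)

lemma left_module_restrict_scalars:
  assumes "left_module A M"
  shows "left_module K (restrict_scalars K A M)"
proof (intro left_module.intro left_module_axioms.intro)
  interpret M: left_module A M by fact
  show "ring K" by (rule R.ring_axioms)
  show "abelian_group (restrict_scalars K A M)"
  proof (rule abelian_groupI)
    fix x assume "x \<in> carrier (restrict_scalars K A M)"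
    then show "\<exists>y \<in> carrier (restrict_scalars K A M).
        y \<oplus>\<^bsub>restrict_scalars K A M\<^esub> x = \<zero>\<^bsub>restrict_scalars K A M\<^esub>"
      by (intro bexI[of _ "\<ominus>\<^bsub>M\<^esub> x"]) (simp_all add: M.M.l_neg)
  qed (simp_all add: M.M.a_ac)
qed (use assms in \<open>simp_all add: left_module.smult_closed left_module.smult_l_distr
      left_module.smult_r_distr left_module.smult_assoc left_module.smult_one smult_l_distr
      smult_one_smult_one\<close>)

lemma Hom_restrict_scalars:
  "f \<in> Hom A M N \<Longrightarrow> f \<in> Hom K (restrict_scalars K A M) (restrict_scalars K A N)"
  by (simp add: Hom_def)

lemma submod_restrict_scalars: "submod A M H \<Longrightarrow> submod K (restrict_scalars K A M) H"
  by (simp add: submod_def)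

lemma fg_mod_spanned:
  assumes "M \<in> fg_mod A"
  shows "\<exists>n. spanned K (restrict_scalars K A M) n (carrier M)"
proof -
  have M: "left_module A M" and fg: "finitely_generated A M"
    using assms by (auto simp: fg_mod_def)
  interpret M: left_module A M by fact
  let ?M = "restrict_scalars K A M"
  interpret V: left_module K ?M using left_module_restrict_scalars[OF M] .
  obtain k where k: "spanned K A k (carrier A)"
    using finite_dim left_module.finitely_generated_iff_spanned[OF left_module_self] by blast
  have "\<exists>m. spanned K ?M m H" if "spanned A M n H" for n H
    using that
  proof (induction rule: spanned.induct)
    case spanned_0
    then show ?case using spanned.spanned_0[of K ?M] by auto
  next
    case (spanned_Suc n H v)
    then obtain m where m: "spanned K ?M m H" by blast
    \<comment> \<open>The multiples of one \<open>A\<close>-generator \<open>v\<close> are the image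
      of \<open>A\<close> under a \<open>K\<close>-linear map, hence are spanned by \<open>k\<close>
      vectors over \<open>K\<close>.\<close>
    have "(\<lambda>a \<in> carrier A. a \<odot>\<^bsub>M\<^esub> v) \<in> Hom K A ?M"
      using spanned_Suc.hyps(2)
      by (simp add: Hom_def M.smult_l_distr M.smult_assoc[symmetric] smult_one_mult)
    from spanned_image[OF left_module_self V.left_module_axioms this k]
    have "spanned K ?M k ((\<lambda>a. a \<odot>\<^bsub>M\<^esub> v) ` carrier A)"
      by (simp cong: image_cong_simp)
    from V.spanned_add[OF this m]
    have "spanned K ?M (k + m) {g \<oplus>\<^bsub>M\<^esub> h | g h. g \<in> (\<lambda>a. a \<odot>\<^bsub>M\<^esub> v) ` carrier A \<and> h \<in> H}"
      by simp
    moreover have "{g \<oplus>\<^bsub>M\<^esub> h | g h. g \<in> (\<lambda>a. a \<odot>\<^bsub>M\<^esub> v) ` carrier A \<and> h \<in> H} =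
        {a \<odot>\<^bsub>M\<^esub> v \<oplus>\<^bsub>M\<^esub> w | a w. a \<in> carrier A \<and> w \<in> H}"
      by blast
    ultimately show ?case by auto
  qed
  then show ?thesis
    using fg M.finitely_generated_iff_spanned by blast
qed

end

section \<open>Characterization of bricks\<close>

text \<open>The units of the endomorphism ring are the automorphisms, and its one differs from its
  zero exactly when the module is nonzero.\<close>

lemma brick_iff:
  assumes "X \<in> fg_mod R"
  shows "brick R X \<longleftrightarrow> (\<exists>x \<in> carrier X. x \<noteq> \<zero>\<^bsub>X\<^esub>) \<and>
    (\<forall>f \<in> Hom R X X. f \<noteq> zero_hom X X \<longrightarrow> f \<in> module_iso R X X)"
    (is "_ \<longleftrightarrow> ?nz \<and> ?iso")
proof
  have X: "left_module R X" using assms by (simp add: fg_mod_def)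
  interpret X: left_module R X by fact
  let ?E = "End_ring R X"
  note E = End_ring_def[of R X]
  {
    assume "brick R X"
    then have sf: "skew_field ?E" by (simp add: brick_def)
    have nz: ?nz
    proof (rule ccontr)
      assume "\<not> ?nz"
      then have "(\<lambda>x \<in> carrier X. x) = zero_hom X X"
        by (auto simp: zero_hom_def restrict_def)
      then show False using skew_field.one_not_zero[OF sf] by (simp add: E)
    qed
    moreover have "f \<in> module_iso R X X" if f: "f \<in> Hom R X X" "f \<noteq> zero_hom X X" for f
    proof -
      have "f \<in> Units ?E"
        using skew_field.Units_eq[OF sf] f by (simp add: E)
      then obtain g where g: "g \<in> Hom R X X" "compose (carrier X) g f = (\<lambda>x \<in> carrier X. x)"
          "compose (carrier X) f g = (\<lambda>x \<in> carrier X. x)"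
        unfolding Units_def by (auto simp: E)
      have "g (f x) = x" "f (g x) = x" if "x \<in> carrier X" for x
        using fun_cong[OF g(2), of x] fun_cong[OF g(3), of x] that by (simp_all add: compose_def)
      then have "bij_betw f (carrier X) (carrier X)"
        using Hom_closed[OF f(1)] Hom_closed[OF g(1)]
        by (intro bij_betw_byWitness[of _ g]) auto
      then show ?thesis using f by (simp add: module_iso_def)
    qed
    ultimately show "?nz \<and> ?iso" by blast
  }
  {
    assume *: "?nz \<and> ?iso"
    interpret E: ring ?E by (rule X.ring_End_ring)
    have one_not_zero: "\<one>\<^bsub>?E\<^esub> \<noteq> \<zero>\<^bsub>?E\<^esub>"
    proof
      assume "\<one>\<^bsub>?E\<^esub> = \<zero>\<^bsub>?E\<^esub>"
      then have "(\<lambda>x \<in> carrier X. x) = zero_hom X X" by (simp add: E)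
      then have "x = \<zero>\<^bsub>X\<^esub>" if "x \<in> carrier X" for x
        using that by (metis restrict_apply' zero_hom_def)
      then show False using * by blast
    qed
    have "Units ?E = carrier ?E - {\<zero>\<^bsub>?E\<^esub>}"
    proof (intro subset_antisym subsetI)
      fix f assume f: "f \<in> Units ?E"
      have "f \<noteq> \<zero>\<^bsub>?E\<^esub>"
      proof
        assume "f = \<zero>\<^bsub>?E\<^esub>"
        then obtain g where "g \<in> carrier ?E" "g \<otimes>\<^bsub>?E\<^esub> \<zero>\<^bsub>?E\<^esub> = \<one>\<^bsub>?E\<^esub>"
          using f unfolding Units_def by blast
        then show False using one_not_zero by simp
      qed
      then show "f \<in> carrier ?E - {\<zero>\<^bsub>?E\<^esub>}" using f by (simp add: E.Units_closed)
    next
      fix f assume "f \<in> carrier ?E - {\<zero>\<^bsub>?E\<^esub>}"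
      then have f: "f \<in> Hom R X X" "f \<noteq> zero_hom X X" by (auto simp: E)
      then have iso: "f \<in> module_iso R X X" using * by blast
      then have bij: "bij_betw f (carrier X) (carrier X)" by (simp add: module_iso_def)
      define g where "g = (\<lambda>y \<in> carrier X. inv_into (carrier X) f y)"
      have g: "g \<in> Hom R X X"
        using Hom_inverse[OF X iso] by (simp add: g_def module_iso_def)
      have "compose (carrier X) g f = (\<lambda>x \<in> carrier X. x)"
        unfolding g_def using bij by (rule compose_inv_into_id)
      moreover have "compose (carrier X) f g = (\<lambda>x \<in> carrier X. x)"
        unfolding g_def using bij compose_id_inv_into[of f "carrier X" "carrier X"]
        by (simp add: bij_betw_def)
      ultimately show "f \<in> Units ?E"
        unfolding Units_def using f g by (auto simp: E)
    qed
    then show "brick R X"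
      using assms one_not_zero E.ring_axioms
      by (simp add: brick_def skew_field_def skew_field_axioms_def)
  }
qed

section \<open>Torsion classes\<close>

lemma torsion_class_subset: "torsion_class R \<T> \<Longrightarrow> \<T> \<subseteq> fg_mod R"
  unfolding torsion_class_def by (elim conjE)

lemma torsion_class_fg: "torsion_class R \<T> \<Longrightarrow> M \<in> \<T> \<Longrightarrow> M \<in> fg_mod R"
  by (rule subsetD[OF torsion_class_subset])

lemma torsion_class_quotient:
  assumes "torsion_class R \<T>" "M \<in> \<T>" "N \<in> fg_mod R" "f \<in> Hom R M N"
    "f ` carrier M = carrier N"
  shows "N \<in> \<T>"
proof -
  have "\<forall>X \<in> \<T>. \<forall>Y \<in> fg_mod R. \<forall>g \<in> Hom R X Y. g ` carrier X = carrier Y \<longrightarrow> Y \<in> \<T>"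
    using assms(1) unfolding torsion_class_def by (elim conjE)
  then show ?thesis using assms(2-5) by blast
qed

lemma torsion_class_image:
  assumes "torsion_class R \<T>" "M \<in> \<T>" "N \<in> fg_mod R" "f \<in> Hom R M N"
  shows "image_module M N f \<in> \<T>"
  using torsion_class_quotient[OF assms(1,2) image_module_fg[OF _ assms(3,4)]
      Hom_image_module[OF assms(4)]] torsion_class_fg[OF assms(1,2)]
  by (simp add: image_module_def)

text \<open>Choose \<open>N\<close> of least dimension. An image of \<open>N\<close> lies in
  \<open>\<T>\<close> again, so if it still maps nontrivially to \<open>X\<close> it cannot be
  smaller. Applied to \<open>g\<close> this gives injectivity, and applied to a nonzero endomorphism
  it gives bijectivity.\<close>

lemma (in fin_dim_algebra) exists_brick_hom:
  assumes T: "torsion_class A \<T>" "M \<in> \<T>" and X: "X \<in> fg_mod A"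
    and f: "f \<in> Hom A M X" "f \<noteq> zero_hom M X"
  shows "\<exists>N \<in> \<T>. brick A N \<and> (\<exists>g \<in> Hom A N X. g \<noteq> zero_hom N X)"
proof -
  define P where "P n \<longleftrightarrow> (\<exists>N \<in> \<T>. (\<exists>g \<in> Hom A N X. g \<noteq> zero_hom N X) \<and>
    spanned K (restrict_scalars K A N) n (carrier N))" for n
  have "\<exists>n. P n"
    unfolding P_def using fg_mod_spanned[OF torsion_class_fg[OF T]] T(2) f by blast
  then have "P (LEAST n. P n)" by (rule LeastI_ex)
  then obtain n N g where n: "n = (LEAST n. P n)" and N: "N \<in> \<T>"
    and g: "g \<in> Hom A N X" "g \<noteq> zero_hom N X"
    and sp: "spanned K (restrict_scalars K A N) n (carrier N)"
    unfolding P_def by blast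
  have least: False if "m < n" "L \<in> \<T>" "h \<in> Hom A L X" "h \<noteq> zero_hom L X"
      "spanned K (restrict_scalars K A L) m (carrier L)" for m L h
    using that not_less_Least[of m P] unfolding n P_def by blast
  have Nfg: "N \<in> fg_mod A" using torsion_class_fg[OF T(1) N] .
  have lN: "left_module A N" and lX: "left_module A X"
    using Nfg X by (auto simp: fg_mod_def)
  have KN: "left_module K (restrict_scalars K A N)"
    using left_module_restrict_scalars[OF lN] .
  \<comment> \<open>A homomorphism with nonzero kernel has an image spanned by fewer than
    \<open>n\<close> vectors.\<close>
  have shrink: "\<exists>m < n. spanned K (restrict_scalars K A L) m (h ` carrier N)"
    if "h \<in> Hom A N L" "left_module A L" "x \<in> carrier N" "x \<noteq> \<zero>\<^bsub>N\<^esub>" "h x = \<zero>\<^bsub>L\<^esub>" for h L x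
    using spanned_image_less[OF K.field_axioms KN left_module_restrict_scalars[OF that(2)]
        Hom_restrict_scalars[OF that(1)] sp] that(3-5) by simp
  have inj: "x = \<zero>\<^bsub>N\<^esub>" if x: "x \<in> carrier N" "g x = \<zero>\<^bsub>X\<^esub>" for x
  proof (rule ccontr)
    assume x0: "x \<noteq> \<zero>\<^bsub>N\<^esub>"
    let ?I = "image_module N X g"
    have I: "?I \<in> \<T>" using torsion_class_image[OF T(1) N X g(1)] .
    then have lI: "left_module A ?I" using torsion_class_fg[OF T(1)] by (auto simp: fg_mod_def)
    obtain m where m: "m < n" "spanned K (restrict_scalars K A ?I) m (g ` carrier N)"
      using shrink[OF Hom_image_module[OF g(1)] lI x(1) x0] x(2) by (auto simp: image_module_def)
    \<comment> \<open>The inclusion of the image of \<open>g\<close> into \<open>X\<close>; it is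
      nonzero because \<open>g\<close> is, so the smaller module \<open>?I\<close> contradicts
      \<open>least\<close>.\<close>
    have i: "restrict (\<lambda>x \<in> carrier X. x) (g ` carrier N) \<in> Hom A ?I X"
      using Hom_image_restrict[OF lN lX g(1) left_module.id_in[OF lX]] .
    obtain y where y: "y \<in> carrier N" "g y \<noteq> \<zero>\<^bsub>X\<^esub>"
      using g Hom_eq_zero_iff[OF g(1)] by blast
    then have "restrict (\<lambda>x \<in> carrier X. x) (g ` carrier N) \<noteq> zero_hom ?I X"
      using Hom_eq_zero_iff[OF i] Hom_closed[OF g(1) y(1)] by (auto simp: image_module_def)
    then show False
      using least[OF m(1) I i] m(2) by (simp add: image_module_def)
  qed
  have "e \<in> module_iso A N N" if e: "e \<in> Hom A N N" "e \<noteq> zero_hom N N" for e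
  proof -
    let ?I = "image_module N N e"
    have I: "?I \<in> \<T>" using torsion_class_image[OF T(1) N Nfg e(1)] .
    have sub: "submod A N (e ` carrier N)"
      using submod_image[OF lN lN e(1) left_module.submod_carrier[OF lN]] .
    have h: "restrict g (e ` carrier N) \<in> Hom A ?I X"
      using Hom_image_restrict[OF lN lN e(1) g(1)] .
    obtain x where x: "x \<in> carrier N" "e x \<noteq> \<zero>\<^bsub>N\<^esub>"
      using e Hom_eq_zero_iff[OF e(1)] by blast
    \<comment> \<open>Injectivity of \<open>g\<close> keeps its restriction to the image of
      \<open>e\<close> nonzero, so this image competes with \<open>N\<close> for least dimension and
      must be all of \<open>N\<close>.\<close>
    then have "g (e x) \<noteq> \<zero>\<^bsub>X\<^esub>" using inj Hom_closed[OF e(1)] by blast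
    then have h0: "restrict g (e ` carrier N) \<noteq> zero_hom ?I X"
      using Hom_eq_zero_iff[OF h] x(1) by (auto simp: image_module_def)
    have surj: "e ` carrier N = carrier N"
    proof (rule ccontr)
      assume ne: "e ` carrier N \<noteq> carrier N"
      obtain m where m: "m \<le> n" "m = n \<longrightarrow> e ` carrier N = carrier N"
          "spanned K (restrict_scalars K A N) m (e ` carrier N)"
        using left_module.spanned_submod_less[OF KN K.field_axioms sp submod_restrict_scalars[OF sub]]
          submodD(1)[OF sub] by blast
      have "spanned K (restrict_scalars K A ?I) m (e ` carrier N)"
        unfolding image_module_def restrict_scalars_submod
        using left_module.spanned_submod_restrict[OF KN m(3) submod_restrict_scalars[OF sub]] by simp
      then show False
        using least[OF _ I h h0, of m] m(1,2) ne by (auto simp: image_module_def)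
    qed
    \<comment> \<open>Since \<open>e\<close> is onto, a nonzero kernel would span \<open>N\<close>
      itself by fewer than \<open>n\<close> vectors.\<close>
    have "inj_on e (carrier N)"
    proof (rule Hom_inj_on[OF lN lN e(1)], rule ccontr)
      fix x assume "x \<in> carrier N" "e x = \<zero>\<^bsub>N\<^esub>" "x \<noteq> \<zero>\<^bsub>N\<^esub>"
      then obtain m where "m < n" "spanned K (restrict_scalars K A N) m (carrier N)"
        using shrink[OF e(1) lN] surj by auto
      then show False using least N g by blast
    qed
    then show ?thesis using e surj by (simp add: module_iso_def bij_betw_def)
  qed
  moreover have "\<exists>x \<in> carrier N. x \<noteq> \<zero>\<^bsub>N\<^esub>"
    using g Hom_eq_zero_iff[OF g(1)] Hom_zero[OF lN lX g(1)] by metis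
  ultimately have "brick A N" using brick_iff[OF Nfg] by blast
  then show ?thesis using N g by blast
qed

lemma torsion_class_extension:
  assumes "torsion_class R \<T>" "X \<in> \<T>" "Z \<in> \<T>" "Y \<in> fg_mod R" "f \<in> Hom R X Y" "g \<in> Hom R Y Z"
    "inj_on f (carrier X)" "f ` carrier X = a_kernel Y Z g" "g ` carrier Y = carrier Z"
  shows "Y \<in> \<T>"
proof -
  have "\<forall>X \<in> \<T>. \<forall>Z \<in> \<T>. \<forall>Y \<in> fg_mod R. \<forall>f \<in> Hom R X Y. \<forall>g \<in> Hom R Y Z.
      inj_on f (carrier X) \<and> f ` carrier X = a_kernel Y Z g \<and> g ` carrier Y = carrier Z \<longrightarrow> Y \<in> \<T>"
    using assms(1) unfolding torsion_class_def by (elim conjE)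
  then show ?thesis using assms(2-9) by blast
qed

section \<open>Nonzero homomorphisms and orthogonality\<close>

definition nonzero_hom ::
    "('a, 'r) ring_scheme \<Rightarrow> ('a, 'b, 'm) module_scheme \<Rightarrow> ('a, 'c, 'n) module_scheme \<Rightarrow> bool" where
  "nonzero_hom R M N \<longleftrightarrow> (\<exists>f \<in> Hom R M N. f \<noteq> zero_hom M N)"

lemma fg_mod_left_module: "M \<in> fg_mod R \<Longrightarrow> left_module R M"
  by (simp add: fg_mod_def)

lemma Hom_trivial_iff_nonzero_hom:
  assumes "left_module R M" "left_module R N"
  shows "Hom R M N = {zero_hom M N} \<longleftrightarrow> \<not> nonzero_hom R M N"
  using zero_hom_Hom[OF assms] unfolding nonzero_hom_def by blast

lemma hom_orthogonal_iff:
  assumes "\<T> \<subseteq> fg_mod R" "X \<in> fg_mod R"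
  shows "X \<in> hom_orthogonal R \<T> \<longleftrightarrow> (\<forall>M \<in> \<T>. \<not> nonzero_hom R M X)"
  using assms Hom_trivial_iff_nonzero_hom[OF fg_mod_left_module fg_mod_left_module, of _ R X]
  by (auto simp: hom_orthogonal_def)

lemma nonzero_hom_iff:
  "nonzero_hom R M N \<longleftrightarrow> (\<exists>f \<in> Hom R M N. \<exists>x \<in> carrier M. f x \<noteq> \<zero>\<^bsub>N\<^esub>)"
  using Hom_eq_zero_iff[of _ R M N] by (auto simp: nonzero_hom_def)

lemma nonzero_hom_self:
  assumes "left_module R M" "x \<in> carrier M" "x \<noteq> \<zero>\<^bsub>M\<^esub>"
  shows "nonzero_hom R M M"
  unfolding nonzero_hom_iff
  by (intro bexI[of _ "\<lambda>x \<in> carrier M. x"] bexI[of _ x] left_module.id_in) (use assms in simp_all)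

lemma brick_fg: "brick R X \<Longrightarrow> X \<in> fg_mod R"
  by (simp add: brick_def)

lemma brick_nonzero_hom_self: "brick R X \<Longrightarrow> nonzero_hom R X X"
  using brick_iff[of X R] nonzero_hom_self[OF fg_mod_left_module, of X R] brick_fg[of R X] by auto

lemma nonzero_hom_precompose:
  assumes "left_module R M" "f \<in> Hom R M N" "f ` carrier M = carrier N" "nonzero_hom R N P"
  shows "nonzero_hom R M P"
proof -
  obtain g y where g: "g \<in> Hom R N P" "y \<in> carrier N" "g y \<noteq> \<zero>\<^bsub>P\<^esub>"
    using assms(4) by (auto simp: nonzero_hom_iff)
  obtain x where "x \<in> carrier M" "y = f x" using g(2) assms(3) by auto
  then show ?thesis
    unfolding nonzero_hom_iff using g Hom_compose[OF assms(1,2) g(1)]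
    by (intro bexI[of _ "compose (carrier M) g f"] bexI[of _ x]) (simp_all add: compose_def)
qed

lemma nonzero_hom_submodule:
  assumes "H \<subseteq> carrier N" "nonzero_hom R M (N\<lparr>carrier := H\<rparr>)"
  shows "nonzero_hom R M N"
proof -
  obtain f x where f: "f \<in> Hom R M (N\<lparr>carrier := H\<rparr>)" "x \<in> carrier M" "f x \<noteq> \<zero>\<^bsub>N\<^esub>"
    using assms(2) by (auto simp: nonzero_hom_iff)
  then have "f \<in> Hom R M N" using assms(1) by (auto simp: Hom_def PiE_iff)
  then show ?thesis using f by (auto simp: nonzero_hom_iff)
qed

text \<open>Left exactness of \<open>Hom\<close> into \<open>W\<close>: a map on \<open>Y\<close>
  that vanishes on the image of \<open>X\<close> factors through \<open>Z\<close>.\<close>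

lemma nonzero_hom_extension:
  assumes lm: "left_module R X" "left_module R Y" "left_module R Z" "left_module R W"
    and fg: "f \<in> Hom R X Y" "g \<in> Hom R Y Z" "f ` carrier X = a_kernel Y Z g"
      "g ` carrier Y = carrier Z"
    and nz: "nonzero_hom R Y W"
  shows "nonzero_hom R X W \<or> nonzero_hom R Z W"
proof (rule ccontr)
  assume "\<not> ?thesis"
  then have zX: "\<And>h x. h \<in> Hom R X W \<Longrightarrow> x \<in> carrier X \<Longrightarrow> h x = \<zero>\<^bsub>W\<^esub>"
    and zZ: "\<And>h x. h \<in> Hom R Z W \<Longrightarrow> x \<in> carrier Z \<Longrightarrow> h x = \<zero>\<^bsub>W\<^esub>"
    by (auto simp: nonzero_hom_iff)
  interpret Y: left_module R Y by (rule lm)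
  interpret W: left_module R W by (rule lm)
  obtain h y where h: "h \<in> Hom R Y W" and y: "y \<in> carrier Y" "h y \<noteq> \<zero>\<^bsub>W\<^esub>"
    using nz by (auto simp: nonzero_hom_iff)
  have ker: "h u = \<zero>\<^bsub>W\<^esub>" if u: "u \<in> carrier Y" "g u = \<zero>\<^bsub>Z\<^esub>" for u
  proof -
    have "u \<in> f ` carrier X" using u unfolding fg(3) a_kernel_def' by simp
    then obtain x where x: "x \<in> carrier X" "u = f x" by blast
    have "compose (carrier X) h f x = \<zero>\<^bsub>W\<^esub>"
      using zX[OF Hom_compose[OF lm(1) fg(1) h] x(1)] .
    then show ?thesis using x by (simp add: compose_def)
  qed
  have fact: "h u = h v" if uv: "u \<in> carrier Y" "v \<in> carrier Y" "g u = g v" for u v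
  proof -
    have "h (u \<ominus>\<^bsub>Y\<^esub> v) = \<zero>\<^bsub>W\<^esub>"
      using uv Hom_eq_imp_zero_diff[OF lm(2,3) fg(2) uv] by (intro ker) auto
    moreover have "u = (u \<ominus>\<^bsub>Y\<^esub> v) \<oplus>\<^bsub>Y\<^esub> v"
      using uv by (simp add: Y.M.minus_eq Y.M.a_assoc Y.M.l_neg)
    then have "h u = h (u \<ominus>\<^bsub>Y\<^esub> v) \<oplus>\<^bsub>W\<^esub> h v"
      using Hom_add[OF h, of "u \<ominus>\<^bsub>Y\<^esub> v" v] uv by simp
    ultimately show ?thesis using Hom_closed[OF h uv(2)] by simp
  qed
  \<comment> \<open>The map induced by \<open>h\<close> on the quotient \<open>Z\<close>; by
    \<open>fact\<close> its values do not depend on the chosen preimage.\<close>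
  define k where "k = (\<lambda>z \<in> carrier Z. h (inv_into (carrier Y) g z))"
  have kg: "k (g u) = h u" if "u \<in> carrier Y" for u
  proof -
    have "g u \<in> g ` carrier Y" using that by blast
    then show ?thesis
      using that fg(4) by (simp add: k_def) (metis fact f_inv_into_f inv_into_into)
  qed
  have "k \<in> Hom R Z W"
    unfolding Hom_def
  proof (intro CollectI conjI ballI)
    show "k \<in> carrier Z \<rightarrow>\<^sub>E carrier W"
    proof (rule PiE_I)
      fix z assume "z \<in> carrier Z"
      then obtain u where "u \<in> carrier Y" "z = g u" using fg(4) by blast
      then show "k z \<in> carrier W" using kg Hom_closed[OF h] by simp
    qed (simp add: k_def)
    fix z z' assume z: "z \<in> carrier Z" "z' \<in> carrier Z"
    then obtain u v where "u \<in> carrier Y" "z = g u" "v \<in> carrier Y" "z' = g v" using fg(4) by blast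
    then show "k (z \<oplus>\<^bsub>Z\<^esub> z') = k z \<oplus>\<^bsub>W\<^esub> k z'"
      by (simp add: kg Hom_add[OF h] flip: Hom_add[OF fg(2)])
  next
    fix a z assume a: "a \<in> carrier R" and "z \<in> carrier Z"
    then obtain u where "u \<in> carrier Y" "z = g u" using fg(4) by blast
    then show "k (a \<odot>\<^bsub>Z\<^esub> z) = a \<odot>\<^bsub>W\<^esub> k z"
      using a by (simp add: kg Hom_smult[OF h] flip: Hom_smult[OF fg(2)])
  qed
  from zZ[OF this Hom_closed[OF fg(2) y(1)]] show False
    using kg[OF y(1)] y(2) by simp
qed

text \<open>Closure under quotients and extensions is the behaviour of nonzero maps proved above.
  The module \<open>X\<close> witnesses the nonemptiness demanded by
  \<open>torsion_class\<close>.\<close>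

lemma torsion_class_left_orthogonal:
  assumes Y: "Y \<in> fg_mod R" and X: "X \<in> fg_mod R" "\<not> nonzero_hom R X Y"
  shows "torsion_class R {M \<in> fg_mod R. \<not> nonzero_hom R M Y}"
  unfolding torsion_class_def
proof (intro conjI ballI impI)
  show "{M \<in> fg_mod R. \<not> nonzero_hom R M Y} \<noteq> {}" using X by blast
  fix M N g assume M: "M \<in> {M \<in> fg_mod R. \<not> nonzero_hom R M Y}" and N: "N \<in> fg_mod R"
    and g: "g \<in> Hom R M N" "g ` carrier M = carrier N"
  then show "N \<in> {M \<in> fg_mod R. \<not> nonzero_hom R M Y}"
    using nonzero_hom_precompose[OF fg_mod_left_module g] by blast
next
  fix M P N f g
  assume MPN: "M \<in> {M \<in> fg_mod R. \<not> nonzero_hom R M Y}" "P \<in> {M \<in> fg_mod R. \<not> nonzero_hom R M Y}"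
    "N \<in> fg_mod R" and fg: "f \<in> Hom R M N" "g \<in> Hom R N P"
    and ex: "inj_on f (carrier M) \<and> f ` carrier M = a_kernel N P g \<and> g ` carrier N = carrier P"
  then show "N \<in> {M \<in> fg_mod R. \<not> nonzero_hom R M Y}"
    using nonzero_hom_extension[OF _ _ _ fg_mod_left_module[OF Y] fg] fg_mod_left_module[of _ R]
    by blast
qed blast

section \<open>Generated torsion classes\<close>

text \<open>An intersection in place of filtrations by quotients of generators; the bound
  \<open>fg_mod R\<close> keeps it among the objects even if no torsion class contains
  \<open>\<G>\<close>.\<close>

definition torsion_closure ::
    "('a, 'r) ring_scheme \<Rightarrow> ('a, nat \<Rightarrow> 'a) module set \<Rightarrow> ('a, nat \<Rightarrow> 'a) module set" where
  "torsion_closure R \<G> = {M \<in> fg_mod R. \<forall>\<T>. torsion_class R \<T> \<and> \<G> \<subseteq> \<T> \<longrightarrow> M \<in> \<T>}"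

lemma torsion_closure_superset: "\<G> \<subseteq> fg_mod R \<Longrightarrow> \<G> \<subseteq> torsion_closure R \<G>"
  by (auto simp: torsion_closure_def)

lemma torsion_closure_least: "torsion_class R \<T> \<Longrightarrow> \<G> \<subseteq> \<T> \<Longrightarrow> torsion_closure R \<G> \<subseteq> \<T>"
  by (auto simp: torsion_closure_def)

lemma torsion_class_torsion_closure:
  assumes "\<G> \<subseteq> fg_mod R" "\<G> \<noteq> {}"
  shows "torsion_class R (torsion_closure R \<G>)"
  unfolding torsion_class_def
proof (intro conjI ballI impI)
  show "torsion_closure R \<G> \<subseteq> fg_mod R"
    by (auto simp: torsion_closure_def)
  show "torsion_closure R \<G> \<noteq> {}"
    using torsion_closure_superset assms by blast
  fix X Y g
  assume "X \<in> torsion_closure R \<G>" "Y \<in> fg_mod R" "g \<in> Hom R X Y" "g ` carrier X = carrier Y"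
  then show "Y \<in> torsion_closure R \<G>"
    using torsion_class_quotient[of R _ X Y g] by (simp add: torsion_closure_def)
next
  fix X Z Y f g
  assume "X \<in> torsion_closure R \<G>" "Z \<in> torsion_closure R \<G>" "Y \<in> fg_mod R" "f \<in> Hom R X Y"
    "g \<in> Hom R Y Z"
    "inj_on f (carrier X) \<and> f ` carrier X = a_kernel Y Z g \<and> g ` carrier Y = carrier Z"
  then show "Y \<in> torsion_closure R \<G>"
    using torsion_class_extension[of R _ X Z Y f g] by (simp add: torsion_closure_def)
qed

text \<open>The modules without nonzero map to \<open>Y\<close> form a torsion class containing the
  generators, hence containing the closure.\<close>

lemma not_nonzero_hom_torsion_closure:
  assumes "\<G> \<subseteq> fg_mod R" "\<G> \<noteq> {}" "Y \<in> fg_mod R" "\<And>M. M \<in> \<G> \<Longrightarrow> \<not> nonzero_hom R M Y"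
    and "M \<in> torsion_closure R \<G>"
  shows "\<not> nonzero_hom R M Y"
proof -
  obtain X where X: "X \<in> \<G>" using assms(2) by blast
  have "torsion_class R {M \<in> fg_mod R. \<not> nonzero_hom R M Y}"
    using torsion_class_left_orthogonal[OF assms(3)] X assms(1,4) by blast
  then show ?thesis
    using torsion_closure_least[of R _ \<G>] assms(1,4,5) by blast
qed

text \<open>Read contrapositively: a brick that receives a nonzero map from a member is itself a
  member, so membership propagates along maps between bricks.\<close>

lemma brick_splittingD:
  assumes "brick_splitting R \<T>" "brick R X" "X \<notin> \<T>" "M \<in> \<T>"
  shows "\<not> nonzero_hom R M X"
proof -
  have T: "torsion_class R \<T>" and "X \<in> hom_orthogonal R \<T>"
    using assms(1-3) by (auto simp: brick_splitting_def)
  then show ?thesis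
    using hom_orthogonal_iff[OF torsion_class_subset[OF T] brick_fg[OF assms(2)]] assms(4) by blast
qed

lemma brick_splittingI:
  assumes T: "torsion_class R \<T>"
    and "\<And>X M. brick R X \<Longrightarrow> X \<notin> \<T> \<Longrightarrow> M \<in> \<T> \<Longrightarrow> \<not> nonzero_hom R M X"
  shows "brick_splitting R \<T>"
  using assms hom_orthogonal_iff[OF torsion_class_subset[OF T] brick_fg]
  unfolding brick_splitting_def by blast

section \<open>Maximal chains and brick-cycles\<close>

text \<open>Adjoining \<open>T\<close> keeps a chain, so maximality forces membership.\<close>

lemma maxchain_memI:
  assumes "subset.maxchain \<A> \<C>" "T \<in> \<A>" "\<And>S. S \<in> \<C> \<Longrightarrow> T \<subseteq> S \<or> S \<subseteq> T"
  shows "T \<in> \<C>"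
proof (rule ccontr)
  assume "T \<notin> \<C>"
  moreover have "subset.chain \<A> (insert T \<C>)"
    using assms unfolding subset.maxchain_def subset_chain_def by auto
  ultimately show False
    using assms(1) unfolding subset.maxchain_def by blast
qed

lemma maxchain_comparable:
  "subset.maxchain \<A> \<C> \<Longrightarrow> S \<in> \<C> \<Longrightarrow> T \<in> \<C> \<Longrightarrow> S \<subseteq> T \<or> T \<subseteq> S"
  unfolding subset.maxchain_def subset_chain_def by blast

lemma Hom_id_iso: "left_module R M \<Longrightarrow> (\<lambda>x \<in> carrier M. x) \<in> module_iso R M M"
  using left_module.id_in[of R M] by (auto simp: module_iso_def bij_betw_def inj_on_def)

lemma isomorphic_refl: "left_module R M \<Longrightarrow> isomorphic R M M"
  using Hom_id_iso unfolding isomorphic_def by blast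

lemma isomorphic_sym: "left_module R M \<Longrightarrow> isomorphic R M N \<Longrightarrow> isomorphic R N M"
  using Hom_inverse unfolding isomorphic_def by blast

lemma torsion_class_isomorphic:
  assumes "torsion_class R \<T>" "M \<in> \<T>" "N \<in> fg_mod R" "isomorphic R M N"
  shows "N \<in> \<T>"
proof -
  obtain f where "f \<in> Hom R M N" "f ` carrier M = carrier N"
    using assms(4) by (auto simp: isomorphic_def module_iso_def bij_betw_def)
  then show ?thesis using torsion_class_quotient[OF assms(1-3)] by blast
qed

section \<open>Paths of bricks\<close>

text \<open>Isomorphisms are allowed here, which makes reachability closed under every nonzero map
  between bricks; \<open>brick_step\<close> excludes them, as brick-cycles do.\<close>

definition brick_arrow ::
    "('a, 'r) ring_scheme \<Rightarrow> ('a, nat \<Rightarrow> 'a) module \<Rightarrow> ('a, nat \<Rightarrow> 'a) module \<Rightarrow> bool" where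
  "brick_arrow R X Y \<longleftrightarrow> brick R X \<and> brick R Y \<and> nonzero_hom R X Y"

definition brick_step ::
    "('a, 'r) ring_scheme \<Rightarrow> ('a, nat \<Rightarrow> 'a) module \<Rightarrow> ('a, nat \<Rightarrow> 'a) module \<Rightarrow> bool" where
  "brick_step R X Y \<longleftrightarrow> brick R X \<and> brick R Y \<and>
     (\<exists>f \<in> Hom R X Y. f \<noteq> zero_hom X Y \<and> f \<notin> module_iso R X Y)"

text \<open>This turns reachability into the indexed data of a brick-cycle, except for the
  isomorphism that closes it.\<close>

lemma brick_step_path:
  assumes "(brick_step R)\<^sup>+\<^sup>+ X Y"
  shows "\<exists>(m::nat) Z f. 1 \<le> m \<and> Z 0 = X \<and> Z m = Y \<and> (\<forall>i \<le> m. brick R (Z i)) \<and>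
    (\<forall>j \<in> {1..m}. f j \<in> Hom R (Z (j - 1)) (Z j) \<and> f j \<noteq> zero_hom (Z (j - 1)) (Z j) \<and>
      f j \<notin> module_iso R (Z (j - 1)) (Z j))"
  using assms
proof (induction rule: tranclp_induct)
  case (base Y)
  then obtain g where g: "brick R X" "brick R Y" "g \<in> Hom R X Y" "g \<noteq> zero_hom X Y"
      "g \<notin> module_iso R X Y"
    by (auto simp: brick_step_def)
  show ?case
    by (intro exI[of _ 1] exI[of _ "\<lambda>i. if i = 0 then X else Y"] exI[of _ "\<lambda>_. g"])
      (use g in auto)
next
  case (step Y W)
  then obtain m :: nat and Z f where IH: "1 \<le> m" "Z 0 = X" "Z m = Y" "\<forall>i \<le> m. brick R (Z i)"
      "\<forall>j \<in> {1..m}. f j \<in> Hom R (Z (j - 1)) (Z j) \<and> f j \<noteq> zero_hom (Z (j - 1)) (Z j) \<and>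
        f j \<notin> module_iso R (Z (j - 1)) (Z j)"
    by blast
  obtain g where g: "brick R W" "g \<in> Hom R Y W" "g \<noteq> zero_hom Y W" "g \<notin> module_iso R Y W"
    using step.hyps(2) by (auto simp: brick_step_def)
  show ?case
    by (intro exI[of _ "Suc m"] exI[of _ "Z(Suc m := W)"] exI[of _ "f(Suc m := g)"])
      (use IH g in \<open>auto simp: le_Suc_eq\<close>)
qed

text \<open>Isomorphisms are contracted along the way: a nonzero map from the current end
  \<open>Z\<close> to the next brick either is an isomorphism, and \<open>Z\<close> stays, or is a
  genuine step that extends the path.\<close>

lemma brick_arrow_path:
  assumes "(brick_arrow R)\<^sup>*\<^sup>* X Y" "brick R X"
  shows "\<exists>Z. (brick_step R)\<^sup>*\<^sup>* X Z \<and> brick R Z \<and> isomorphic R Z Y"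
  using assms(1)
proof (induction rule: rtranclp_induct)
  case base
  then show ?case
    using assms(2) isomorphic_refl[OF fg_mod_left_module[OF brick_fg]] by blast
next
  case (step Y W)
  then obtain Z i where Z: "(brick_step R)\<^sup>*\<^sup>* X Z" "brick R Z"
    and i: "i \<in> Hom R Z Y" "i ` carrier Z = carrier Y"
    by (auto simp: isomorphic_def module_iso_def bij_betw_def)
  have W: "brick R W" and "nonzero_hom R Y W"
    using step.hyps(2) by (auto simp: brick_arrow_def)
  then obtain h where h: "h \<in> Hom R Z W" "h \<noteq> zero_hom Z W"
    using nonzero_hom_precompose[OF fg_mod_left_module[OF brick_fg[OF Z(2)]] i]
    by (auto simp: nonzero_hom_def)
  show ?case
  proof (cases "h \<in> module_iso R Z W")
    case True
    then show ?thesis using Z by (auto simp: isomorphic_def)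
  next
    case False
    then have "brick_step R Z W" using h Z(2) W by (auto simp: brick_step_def)
    then show ?thesis
      using Z(1) W isomorphic_refl[OF fg_mod_left_module[OF brick_fg[OF W]]]
      by (meson rtranclp.rtrancl_into_rtrancl)
  qed
qed

text \<open>If \<open>N\<close> and \<open>X\<close> were not isomorphic, the arrow would be a step,
  and the return path, freed of isomorphisms, would end at a copy of \<open>N\<close> and close a
  brick-cycle.\<close>

lemma brick_directed_antisym:
  assumes dir: "brick_directed R" and NX: "brick_arrow R N X" and XN: "(brick_arrow R)\<^sup>*\<^sup>* X N"
  shows "isomorphic R N X"
proof (rule ccontr)
  assume not_iso: "\<not> isomorphic R N X"
  have N: "brick R N" and X: "brick R X" using NX by (auto simp: brick_arrow_def)
  have "brick_step R N X"
    using NX not_iso by (auto simp: brick_arrow_def brick_step_def nonzero_hom_def isomorphic_def)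
  moreover obtain Z where Z: "(brick_step R)\<^sup>*\<^sup>* X Z" "brick R Z" "isomorphic R Z N"
    using brick_arrow_path[OF XN X] by blast
  ultimately have "(brick_step R)\<^sup>+\<^sup>+ N Z" by (meson rtranclp_into_tranclp2)
  then obtain m :: nat and Y f where "1 \<le> m" "Y 0 = N" "Y m = Z" "\<forall>i \<le> m. brick R (Y i)"
      "\<forall>j \<in> {1..m}. f j \<in> Hom R (Y (j - 1)) (Y j) \<and> f j \<noteq> zero_hom (Y (j - 1)) (Y j) \<and>
        f j \<notin> module_iso R (Y (j - 1)) (Y j)"
    using brick_step_path by metis
  then have "brick_cycle R m Y f"
    using isomorphic_sym[OF fg_mod_left_module[OF brick_fg[OF Z(2)]] Z(3)]
    unfolding brick_cycle_def by simp
  then show False using dir unfolding brick_directed_def by blast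
qed

section \<open>From a brick-splitting maximal chain to brick-directedness\<close>

text \<open>The assumption \<open>pull\<close> is all that is kept of the cycle. Together with
  brick-splitting, which pushes membership from \<open>X\<close> to \<open>Y\<close>, it puts both
  bricks into the same members of the chain.\<close>

lemma maxchain_brick_iso:
  assumes max: "subset.maxchain (tors R) \<C>" and split: "\<And>S. S \<in> \<C> \<Longrightarrow> brick_splitting R S"
    and X: "brick R X" and Y: "brick R Y"
    and f: "f \<in> Hom R X Y" "f \<noteq> zero_hom X Y"
    and pull: "\<And>S. S \<in> \<C> \<Longrightarrow> Y \<in> S \<Longrightarrow> X \<in> S"
  shows "f \<in> module_iso R X Y"
proof -
  have Xfg: "X \<in> fg_mod R" and Yfg: "Y \<in> fg_mod R" using X Y brick_fg by auto
  have lX: "left_module R X" and lY: "left_module R Y" using Xfg Yfg fg_mod_left_module by auto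
  define \<V> where "\<V> = \<Union>{S \<in> \<C>. X \<notin> S}"
  define \<W> where "\<W> = torsion_closure R (insert Y \<V>)"
  have tc: "torsion_class R S" if "S \<in> \<C>" for S
    using split[OF that] by (simp add: brick_splitting_def)
  have sub: "insert Y \<V> \<subseteq> fg_mod R"
    using Yfg torsion_class_fg[OF tc] by (auto simp: \<V>_def)
  have W: "torsion_class R \<W>"
    unfolding \<W>_def by (rule torsion_class_torsion_closure[OF sub]) blast
  have VW: "insert Y \<V> \<subseteq> \<W>"
    unfolding \<W>_def by (rule torsion_closure_superset[OF sub])
  have "\<W> \<in> \<C>"
  proof (rule maxchain_memI[OF max])
    show "\<W> \<in> tors R" using W by (simp add: tors_def)
    fix S assume S: "S \<in> \<C>"
    show "\<W> \<subseteq> S \<or> S \<subseteq> \<W>"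
    \<comment> \<open>A member with \<open>X\<close> contains \<open>Y\<close> and, as the chain is
      totally ordered, all of \<open>\<V>\<close>; a member without \<open>X\<close> is part of
      \<open>\<V>\<close>.\<close>
    proof (cases "X \<in> S")
      case True
      have "Y \<in> S"
        using brick_splittingD[OF split[OF S] Y _ True] f by (auto simp: nonzero_hom_def)
      moreover have "\<V> \<subseteq> S"
        using maxchain_comparable[OF max S] True unfolding \<V>_def by blast
      ultimately show ?thesis
        unfolding \<W>_def using torsion_closure_least[OF tc[OF S]] by blast
    next
      case False
      then have "S \<subseteq> \<V>" using S unfolding \<V>_def by blast
      then show ?thesis using VW by blast
    qed
  qed
  then have XW: "X \<in> \<W>" using pull VW by blast
  \<comment> \<open>The identity is a nonzero map from a member of the closure to \<open>L\<close>,
    so some generator maps nontrivially to \<open>L\<close>; with \<open>\<V>\<close> excluded, it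
    is \<open>Y\<close>.\<close>
  have from_Y: "nonzero_hom R Y L"
    if L: "L \<in> \<W>" "nonzero_hom R L L" "\<And>M. M \<in> \<V> \<Longrightarrow> \<not> nonzero_hom R M L" for L
    using not_nonzero_hom_torsion_closure[OF sub _ torsion_class_fg[OF W L(1)], of L] L
    unfolding \<W>_def by blast
  \<comment> \<open>By \<open>pull\<close>, a member of the chain without \<open>X\<close> is also
    without \<open>Y\<close>, so splitting applies to both bricks.\<close>
  have VX: "\<not> nonzero_hom R M X" and VY: "\<not> nonzero_hom R M Y" if "M \<in> \<V>" for M
    using that brick_splittingD[OF split X] brick_splittingD[OF split Y] pull
    unfolding \<V>_def by blast+
  let ?I = "image_module X Y f"
  have fI: "f ` carrier X \<subseteq> carrier Y" using Hom_closed[OF f(1)] by blast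
  have "nonzero_hom R Y ?I"
  proof (rule from_Y)
    show "?I \<in> \<W>" by (rule torsion_class_image[OF W XW Yfg f(1)])
    then have "left_module R ?I" using torsion_class_fg[OF W] fg_mod_left_module by blast
    moreover obtain x where "x \<in> carrier X" "f x \<noteq> \<zero>\<^bsub>Y\<^esub>"
      using f Hom_eq_zero_iff[OF f(1)] by blast
    ultimately show "nonzero_hom R ?I ?I"
      using nonzero_hom_self[of R ?I "f x"] by (simp add: image_module_def)
    show "\<not> nonzero_hom R M ?I" if "M \<in> \<V>" for M
      using VY[OF that] nonzero_hom_submodule[OF fI] unfolding image_module_def by blast
  qed
  then obtain u y where u: "u \<in> Hom R Y ?I" and y: "y \<in> carrier Y" "u y \<noteq> \<zero>\<^bsub>Y\<^esub>"
    unfolding nonzero_hom_iff by (auto simp: image_module_def)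
  \<comment> \<open>Viewed as an endomorphism of the brick \<open>Y\<close>, the nonzero
    \<open>u\<close> is an automorphism. Its values lie in the image of \<open>f\<close>, so
    \<open>f\<close> is onto.\<close>
  have uY: "u \<in> Hom R Y Y"
    using u fI by (auto simp: Hom_def image_module_def PiE_iff)
  then have "u \<in> module_iso R Y Y"
    using brick_iff[OF Yfg] Y y Hom_eq_zero_iff[OF uY] by blast
  then have "u ` carrier Y = carrier Y" by (simp add: module_iso_def bij_betw_def)
  moreover have "u ` carrier Y \<subseteq> f ` carrier X"
    using Hom_closed[OF u] by (auto simp: image_module_def)
  ultimately have surj: "f ` carrier X = carrier Y" using fI by blast
  have "nonzero_hom R Y X"
    using from_Y[OF XW brick_nonzero_hom_self[OF X] VX] .
  then obtain v z where v: "v \<in> Hom R Y X" and z: "z \<in> carrier Y" "v z \<noteq> \<zero>\<^bsub>X\<^esub>"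
    unfolding nonzero_hom_iff by blast
  obtain x where x: "x \<in> carrier X" "z = f x" using z(1) surj by blast
  \<comment> \<open>As \<open>f\<close> is onto, the composite does not vanish at \<open>x\<close>;
    a nonzero endomorphism of the brick \<open>X\<close> is injective, hence so is
    \<open>f\<close>.\<close>
  let ?c = "compose (carrier X) v f"
  have c: "?c \<in> Hom R X X" by (rule Hom_compose[OF lX f(1) v])
  have "?c \<noteq> zero_hom X X"
    using Hom_eq_zero_iff[OF c] x z(2) by (auto simp: compose_def)
  then have "?c \<in> module_iso R X X"
    using brick_iff[OF Xfg] X c by blast
  then have "inj_on ?c (carrier X)" by (simp add: module_iso_def bij_betw_def)
  then have "inj_on f (carrier X)"
    by (auto simp: inj_on_def compose_def)
  then show ?thesis
    using f(1) surj by (simp add: module_iso_def bij_betw_def)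
qed

lemma maxchain_brick_splitting_imp_brick_directed:
  assumes max: "subset.maxchain (tors R) \<C>" and split: "\<And>S. S \<in> \<C> \<Longrightarrow> brick_splitting R S"
  shows "brick_directed R"
  unfolding brick_directed_def
proof clarify
  fix m X f assume cyc: "brick_cycle R m X f"
  have m: "1 \<le> m" and brick: "\<And>i. i \<le> m \<Longrightarrow> brick R (X i)" and iso: "isomorphic R (X 0) (X m)"
    and arr: "\<And>j. j \<in> {1..m} \<Longrightarrow> f j \<in> Hom R (X (j - 1)) (X j) \<and>
        f j \<noteq> zero_hom (X (j - 1)) (X j) \<and> f j \<notin> module_iso R (X (j - 1)) (X j)"
    using cyc unfolding brick_cycle_def by blast+
  \<comment> \<open>Membership travels around the cycle from \<open>X 1\<close> to
    \<open>X m\<close> and over the closing isomorphism to \<open>X 0\<close>; this is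
    \<open>pull\<close> for the first map.\<close>
  have "X 0 \<in> S" if S: "S \<in> \<C>" "X 1 \<in> S" for S
  proof -
    have "X i \<in> S" if "1 \<le> i" "i \<le> m" for i
      using that
    proof (induction i rule: dec_induct)
      case (step i)
      have "nonzero_hom R (X i) (X (Suc i))"
        using arr[of "Suc i"] step.prems unfolding nonzero_hom_def by auto
      then show ?case
        using brick_splittingD[OF split[OF S(1)] brick[OF step.prems]] step by auto
    qed (rule S(2))
    then have "X m \<in> S" using m by simp
    moreover have "isomorphic R (X m) (X 0)"
      using isomorphic_sym[OF fg_mod_left_module[OF brick_fg[OF brick[of 0]]] iso] by simp
    ultimately show ?thesis
      using torsion_class_isomorphic[of R S "X m" "X 0"] split[OF S(1)] brick_fg[OF brick[of 0]]
      by (simp add: brick_splitting_def)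
  qed
  then have "f 1 \<in> module_iso R (X 0) (X 1)"
    using maxchain_brick_iso[OF max split brick[of 0] brick[of 1], of "f 1"] arr[of 1] m by simp
  then show False using arr[of 1] m by simp
qed

section \<open>From brick-directedness to a brick-splitting maximal chain\<close>

text \<open>By \<open>mem\<close>, a torsion class comparable with the whole chain already belongs
  to it, so no larger chain of torsion classes exists.\<close>

lemma (in fin_dim_algebra) brick_directed_imp_maxchain:
  assumes dir: "brick_directed A"
    and max: "subset.maxchain {\<T>. brick_splitting A \<T>} \<C>"
  shows "subset.maxchain (tors A) \<C>"
proof -
  have split: "brick_splitting A S" if "S \<in> \<C>" for S
    using max that unfolding subset.maxchain_def subset_chain_def by blast
  have tc: "torsion_class A S" if "S \<in> \<C>" for S
    using split[OF that] by (simp add: brick_splitting_def)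
  have mem: "\<T> \<in> \<C>" if T: "torsion_class A \<T>" and comp: "\<And>S. S \<in> \<C> \<Longrightarrow> \<T> \<subseteq> S \<or> S \<subseteq> \<T>" for \<T>
  proof (rule ccontr)
    assume "\<T> \<notin> \<C>"
    then have "\<not> brick_splitting A \<T>"
      using maxchain_memI[OF max _ comp] by blast
    then obtain X M where X: "brick A X" "X \<notin> \<T>" and M: "M \<in> \<T>" "nonzero_hom A M X"
      using brick_splittingI[OF T] by blast
    \<comment> \<open>The failure of splitting yields only a module \<open>M\<close>; a brick is
      required to build a brick-cycle.\<close>
    obtain N where N: "N \<in> \<T>" "brick A N" "nonzero_hom A N X"
      using exists_brick_hom[OF T M(1) brick_fg[OF X(1)]] M(2) unfolding nonzero_hom_def by blast
    define \<V> where "\<V> = \<Union>{S \<in> \<C>. X \<notin> S}"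
    define \<P> where "\<P> = {Z. (brick_arrow A)\<^sup>*\<^sup>* X Z}"
    define \<W> where "\<W> = torsion_closure A (\<V> \<union> \<P>)"
    have P_brick: "brick A Z" if "Z \<in> \<P>" for Z
      using that X(1) unfolding \<P>_def by (auto elim: rtranclp.cases simp: brick_arrow_def)
    have XP: "X \<in> \<P>" by (simp add: \<P>_def)
    have sub: "\<V> \<union> \<P> \<subseteq> fg_mod A"
      using torsion_class_fg[OF tc] brick_fg[OF P_brick] by (auto simp: \<V>_def)
    have ne: "\<V> \<union> \<P> \<noteq> {}" using XP by blast
    have W: "torsion_class A \<W>"
      unfolding \<W>_def by (rule torsion_class_torsion_closure[OF sub ne])
    have VW: "\<V> \<union> \<P> \<subseteq> \<W>"
      unfolding \<W>_def by (rule torsion_closure_superset[OF sub])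
    \<comment> \<open>It suffices to test generators: those in \<open>\<V>\<close> are handled by
      splitting, those in \<open>\<P>\<close> because \<open>\<P>\<close> is closed under arrows.
      This makes \<open>\<W>\<close> brick-splitting and shows that its bricks are all
      generators.\<close>
    have orth: "\<not> nonzero_hom A L Z" if Z: "brick A Z" "Z \<notin> \<V> \<union> \<P>" and L: "L \<in> \<W>" for Z L
    proof (rule not_nonzero_hom_torsion_closure[OF sub ne brick_fg[OF Z(1)] _ L[unfolded \<W>_def]])
      fix Q assume "Q \<in> \<V> \<union> \<P>"
      then show "\<not> nonzero_hom A Q Z"
      proof
        assume "Q \<in> \<V>"
        then obtain S where S: "S \<in> \<C>" "X \<notin> S" "Q \<in> S" unfolding \<V>_def by blast
        then have "Z \<notin> S" using Z(2) unfolding \<V>_def by blast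
        then show ?thesis using brick_splittingD[OF split[OF S(1)] Z(1)] S(3) by blast
      next
        assume Q: "Q \<in> \<P>"
        show ?thesis
        proof
          assume "nonzero_hom A Q Z"
          then have "brick_arrow A Q Z" using P_brick[OF Q] Z(1) by (simp add: brick_arrow_def)
          then have "Z \<in> \<P>" using Q unfolding \<P>_def by auto
          then show False using Z(2) by blast
        qed
      qed
    qed
    have "\<W> \<in> \<C>"
    proof (rule maxchain_memI[OF max])
      show "\<W> \<in> {\<T>. brick_splitting A \<T>}"
        using brick_splittingI[OF W] orth VW by blast
      fix S assume S: "S \<in> \<C>"
      show "\<W> \<subseteq> S \<or> S \<subseteq> \<W>"
      proof (cases "X \<in> S")
        case True
        \<comment> \<open>Splitting propagates membership in \<open>S\<close> from \<open>X\<close>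
          along every path of arrows.\<close>
        have "Z \<in> S" if "(brick_arrow A)\<^sup>*\<^sup>* X Z" for Z
          using that
        proof (induction rule: rtranclp_induct)
          case (step Y Z)
          then show ?case
            using brick_splittingD[OF split[OF S]] unfolding brick_arrow_def by blast
        qed (rule True)
        then have "\<P> \<subseteq> S" unfolding \<P>_def by blast
        moreover have "\<V> \<subseteq> S"
          using maxchain_comparable[OF max S] True unfolding \<V>_def by blast
        ultimately show ?thesis
          unfolding \<W>_def using torsion_closure_least[OF tc[OF S]] by blast
      next
        case False
        then have "S \<subseteq> \<V>" using S unfolding \<V>_def by blast
        then show ?thesis using VW by blast
      qed
    qed
    moreover have "X \<in> \<W>" using VW XP by blast
    \<comment> \<open>Comparability leaves only \<open>\<T>\<close> inside \<open>\<W>\<close>,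
      since \<open>X\<close> lies in \<open>\<W>\<close> but not in \<open>\<T>\<close>.\<close>
    ultimately have "N \<in> \<W>" using comp[of \<W>] X(2) N(1) by blast
    \<comment> \<open>\<open>orth\<close> is applied with \<open>N\<close> in both places: the
      identity of a brick is nonzero, so \<open>N\<close> is a generator.\<close>
    then have "N \<in> \<V> \<union> \<P>" using orth[OF N(2), of N] brick_nonzero_hom_self[OF N(2)] by blast
    \<comment> \<open>A member of the chain containing \<open>N\<close> also contains
      \<open>X\<close>, because \<open>N\<close> maps nontrivially to \<open>X\<close>.\<close>
    moreover have "N \<notin> \<V>"
      using brick_splittingD[OF split X(1)] N(3) unfolding \<V>_def by blast
    ultimately have "(brick_arrow A)\<^sup>*\<^sup>* X N" unfolding \<P>_def by blast
    then have "isomorphic A N X"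
      using brick_directed_antisym[OF dir] N(2,3) X(1) unfolding brick_arrow_def by blast
    then show False
      using torsion_class_isomorphic[OF T N(1) brick_fg[OF X(1)]] X(2) by blast
  qed
  show ?thesis
    unfolding subset.maxchain_def
  proof (intro conjI notI)
    show "subset.chain (tors A) \<C>"
      using max tc unfolding subset.maxchain_def subset_chain_def tors_def by blast
    assume "\<exists>\<D>. subset.chain (tors A) \<D> \<and> \<C> \<subset> \<D>"
    then obtain \<D> \<T> where D: "subset.chain (tors A) \<D>" "\<C> \<subseteq> \<D>" "\<T> \<in> \<D>" "\<T> \<notin> \<C>"
      by blast
    then have "torsion_class A \<T>" and "\<And>S. S \<in> \<C> \<Longrightarrow> \<T> \<subseteq> S \<or> S \<subseteq> \<T>"
      unfolding subset_chain_def tors_def by blast+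
    then show False using mem D(4) by blast
  qed
qed

theorem theorem1p4:
  fixes K :: "('k, 'r) ring_scheme" and A :: "('k, 'a, 's) module_scheme"
  assumes "fin_dim_algebra K A"
  shows "brick_directed A \<longleftrightarrow>
    (\<exists>\<C>. subset.maxchain (tors A) \<C> \<and> (\<forall>\<T> \<in> \<C>. brick_splitting A \<T>))"
proof
  assume dir: "brick_directed A"
  \<comment> \<open>Hausdorff's principle is applied inside the brick-splitting classes;
    brick-directedness then upgrades the maximality to all of \<open>tors A\<close>.\<close>
  obtain \<C> where C: "subset.maxchain {\<T>. brick_splitting A \<T>} \<C>"
    using subset.Hausdorff by blast
  then have "\<forall>\<T> \<in> \<C>. brick_splitting A \<T>"
    unfolding subset.maxchain_def subset_chain_def by blast
  then show "\<exists>\<C>. subset.maxchain (tors A) \<C> \<and> (\<forall>\<T> \<in> \<C>. brick_splitting A \<T>)"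
    using fin_dim_algebra.brick_directed_imp_maxchain[OF assms dir C] by blast
next
  assume "\<exists>\<C>. subset.maxchain (tors A) \<C> \<and> (\<forall>\<T> \<in> \<C>. brick_splitting A \<T>)"
  then show "brick_directed A"
    using maxchain_brick_splitting_imp_brick_directed by blast
qed

end
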